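(* Let $D[x,\rho]=d[x,\rho]\rho$ with $d[x,\rho]>0$. For any two positive distributions $\hat\rho_0$ and $\hat\rho_1$ over $\mathbb{R}$ with the same first moment, $$d_{\mathcal{C}_D}^2(\hat\rho_0,\hat\rho_1)=d_{\mathfrak{L},\mathcal{C}_D}^2\big(\mathbf{L}[\hat\rho_0],\mathbf{L}[\hat\rho_1]\big).$$
   Context: Positive distributions over $\mathbb{R}$ are positive probability densities on $\mathbb{R}$ (absolutely continuous w.r.t. Lebesgue measure); their set is $\mathcal{P}_{+,ac}(\mathbb{R})$. For a density $\rho$, $C[\rho](x)=\int_{-\infty}^x\rho(y)\,dy$ is its cdf and $G[\rho]$ its inverse cdf. The Lorenz curve of $\rho$ is the function $\mathbf{L}[\rho]:[0,1]\to\mathbb{R}$, $\mathbf{L}[\rho](f)=\int_{-\infty}^{G[\rho](f)}y\rho(y)\,dy$. $\mathfrak{L}(\mathbb{R})=\{\mathbf{L}[\rho]:\rho\in\mathcal{P}_{+,ac}(\mathbb{R})\}$. A dot denotes a time derivative; a subscript $t$ denotes the time parameter, not a derivative. All spaces of densities and of Lorenz curves are viewed as formal infinite-dimensional Riemannian manifolds, and curves are smooth. $D:\mathbb{R}\times\mathcal{P}_{+,ac}(\mathbb{R})\to\mathbb{R}^+$. The $\mathcal{C}_D$ distance between densities with the same first moment is $$d_{\mathcal{C}_D}^2(\hat\rho_0,\hat\rho_1)=\inf_{\text{curves }\rho_t}\left\{\int_0^1dt\int_{\mathbb{R}}dx\,D[x,\rho_t]\left(\frac{\partial^2\psi_t}{\partial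 x^2}\right)^2\ \text{where}\ \frac{\partial\rho_t}{\partial t}=\frac{\partial^2}{\partial x^2}\left(D[x,\rho_t]\frac{\partial^2\psi_t}{\partial x^2}\right)\ :\ \rho_0=\hat\rho_0,\ \rho_1=\hat\rho_1,\ \frac{d}{dt}\int_{\mathbb{R}}x\rho_t(x)\,dx=0\right\}.$$ In Lorenz variables, $\widetilde d[f,\mathcal{L}]=d\left[\mathcal{L}'(f),\,1/\mathcal{L}''(f)\right]$, which equals $d[x,\rho]$ when evaluated at $f=C[\rho](x)$ and $\mathcal{L}=\mathbf{L}[\rho]$. On perturbations $\eta$ of Lorenz curves in $\mathbb{T}_0=\{\eta:[0,1]\to\mathbb{R}:\eta(0)=\eta'(0)=\eta'(1)=\eta(1)=0\}$ one has the norm $\|\eta\|^2_{\mathfrak{L},\mathcal{C}_D,\mathcal{L}}=\int_0^1\frac{1}{\widetilde d[f,\mathcal{L}]}\left(\mathcal{L}''(f)\right)^2\eta(f)^2\,df$. The distance between Lorenz curves $\hat L_0,\hat L_1$ with $\hat L_0(1)=\hat L_1(1)$ is $$d^2_{\mathfrak{L},\mathcal{C}_D}(\hat L_0,\hat L_1)=\inf_{\text{curves }\mathcal{L}_t}\left\{\int_0^1dt\,\|\dot{\mathcal{L}}_t\|^2_{\mathfrak{L},\mathcal{C}_D,\mathcal{L}_t}\ :\ \mathcal{L}_0=\hat L_0,\ \mathcal{L}_1=\hat L_1,\ \frac{d\mathcal{L}_t(1)}{dt}=0\right\},$$ i.e. the integrand is $\int_0^1df\,\frac{1}{\widetilde d[f,\mathcal{L}_t]}\left(\frac{\partial^2\mathcal{L}_t}{\partial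 f^2}\right)^2\left(\dot{\mathcal{L}}_t(f)\right)^2$, the infimum being over curves $\mathcal{L}_t$, $t\in[0,1]$, in $\mathfrak{L}(\mathbb{R})$.
   Formalization: Assumes d[x,ρ] continuous in x for smooth ρ, and that D ∂²ψ/∂x² → 0 as |x|→∞ uniformly in t (else the identity fails, e.g. d=1/ρ²); Lorenz curves have L''>0 and velocity continuous on [0,1], without imposing η'(0)=η'(1)=0; first moments are finite. *)

theory Defs
  imports "HOL-Analysis.Analysis"
begin

section \<open>Positive densities, cumulative distribution functions and Lorenz curves\<close>

text \<open>
  Densities are represented by functions; two functions that agree almost everywhere represent
  the same distribution.  The first moment is required to be finite, since otherwise neither the
  Lorenz curve nor the constraint of a fixed mean makes sense (and the library integral would
  silently return 0).
\<close>

definition pos_densities :: "(real \<Rightarrow> real) set" where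
  "pos_densities = {\<rho>. \<rho> \<in> borel_measurable borel \<and> (\<forall>x. 0 < \<rho> x) \<and>
     integrable lborel \<rho> \<and> (LINT x|lborel. \<rho> x) = 1 \<and> integrable lborel (\<lambda>x. x * \<rho> x)}"

definition first_moment :: "(real \<Rightarrow> real) \<Rightarrow> real" where
  "first_moment \<rho> = (LINT x|lborel. x * \<rho> x)"

definition cum_dist :: "(real \<Rightarrow> real) \<Rightarrow> real \<Rightarrow> real" where
  "cum_dist \<rho> x = (LBINT y=-\<infinity>..ereal x. \<rho> y)"

text \<open>
  For a positive density the cdf is a bijection from the real line onto the open unit interval;
  its inverse is extended by the limits at 0 and 1.
\<close>

definition inv_cum_dist :: "(real \<Rightarrow> real) \<Rightarrow> real \<Rightarrow> ereal" where
  "inv_cum_dist \<rho> f =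
     (if f \<le> 0 then -\<infinity> else if f \<ge> 1 then \<infinity> else ereal (inv (cum_dist \<rho>) f))"

definition lorenz :: "(real \<Rightarrow> real) \<Rightarrow> real \<Rightarrow> real" where
  "lorenz \<rho> = (\<lambda>f\<in>{0..1}. LBINT y=-\<infinity>..inv_cum_dist \<rho> f. y * \<rho> y)"

definition lorenz_curves :: "(real \<Rightarrow> real) set" where
  "lorenz_curves = lorenz ` pos_densities"


section \<open>Smoothness\<close>

definition smooth_line :: "(real \<Rightarrow> real) \<Rightarrow> bool" where
  "smooth_line u \<longleftrightarrow> (\<forall>n. (deriv ^^ n) u differentiable_on UNIV)"

text \<open>
  The intended domains are \<open>T = {0..1}\<close> (one-sided time derivatives at the ends) and \<open>X\<close> an open
  interval: all partial derivatives of all orders exist and are continuous on \<open>T \<times> X\<close>.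
\<close>

fun Cn_on :: "nat \<Rightarrow> real set \<Rightarrow> real set \<Rightarrow> (real \<Rightarrow> real \<Rightarrow> real) \<Rightarrow> bool" where
  "Cn_on 0 T X u \<longleftrightarrow> continuous_on (T \<times> X) (\<lambda>(t, x). u t x)"
| "Cn_on (Suc n) T X u \<longleftrightarrow> continuous_on (T \<times> X) (\<lambda>(t, x). u t x) \<and>
     (\<exists>ut ux. Cn_on n T X ut \<and> Cn_on n T X ux \<and>
        (\<forall>t\<in>T. \<forall>x\<in>X. ((\<lambda>s. u s x) has_real_derivative ut t x) (at t within T) \<and>
                        (u t has_real_derivative ux t x) (at x within X)))"

definition smooth2_on :: "real set \<Rightarrow> real set \<Rightarrow> (real \<Rightarrow> real \<Rightarrow> real) \<Rightarrow> bool" where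
  "smooth2_on T X u \<longleftrightarrow> (\<forall>n. Cn_on n T X u)"


section \<open>The distance between densities\<close>

definition CD_flux ::
  "(real \<Rightarrow> (real \<Rightarrow> real) \<Rightarrow> real) \<Rightarrow> (real \<Rightarrow> real \<Rightarrow> real) \<Rightarrow> (real \<Rightarrow> real \<Rightarrow> real)
    \<Rightarrow> real \<Rightarrow> real \<Rightarrow> real" where
  "CD_flux D \<rho> \<psi> t x = D x (\<rho> t) * deriv (deriv (\<psi> t)) x"

text \<open>
  The evolution equation determines the flux \<open>D \<partial>\<^sub>x\<^sub>x \<psi>\<close> only up to an affine function of \<open>x\<close>.  As
  usual for such equations on the whole line, the flux is required to vanish at infinity
  (uniformly in time), which is what removes the boundary terms when integrating by parts.
  In Lorenz variables this is \<open>\<eta>(0) = \<eta>(1) = 0\<close> for the velocity \<open>\<eta>\<close>.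

  Endpoints are compared as distributions, i.e. almost everywhere.
\<close>

definition CD_curve ::
  "(real \<Rightarrow> (real \<Rightarrow> real) \<Rightarrow> real) \<Rightarrow> (real \<Rightarrow> real) \<Rightarrow> (real \<Rightarrow> real)
    \<Rightarrow> (real \<Rightarrow> real \<Rightarrow> real) \<Rightarrow> (real \<Rightarrow> real \<Rightarrow> real) \<Rightarrow> bool" where
  "CD_curve D \<rho>0 \<rho>1 \<rho> \<psi> \<longleftrightarrow>
     (\<forall>t\<in>{0..1}. \<rho> t \<in> pos_densities) \<and>
     smooth2_on {0..1} UNIV \<rho> \<and>
     (\<forall>t\<in>{0..1}. \<psi> t differentiable_on UNIV \<and> deriv (\<psi> t) differentiable_on UNIV) \<and>
     smooth2_on {0..1} UNIV (CD_flux D \<rho> \<psi>) \<and>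
     uniform_limit {0..1} (\<lambda>x t. CD_flux D \<rho> \<psi> t x) (\<lambda>t. 0) at_bot \<and>
     uniform_limit {0..1} (\<lambda>x t. CD_flux D \<rho> \<psi> t x) (\<lambda>t. 0) at_top \<and>
     (\<forall>t\<in>{0..1}. \<forall>x.
        ((\<lambda>s. \<rho> s x) has_real_derivative deriv (deriv (CD_flux D \<rho> \<psi> t)) x) (at t within {0..1})) \<and>
     (AE x in lborel. \<rho> 0 x = \<rho>0 x) \<and>
     (AE x in lborel. \<rho> 1 x = \<rho>1 x) \<and>
     (\<forall>t\<in>{0..1}. ((\<lambda>s. first_moment (\<rho> s)) has_real_derivative 0) (at t within {0..1}))"

text \<open>Squared distances take values in \<open>ennreal\<close>; the infimum over no curve is \<open>\<infinity>\<close>.\<close>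

definition CD_dist_sq ::
  "(real \<Rightarrow> (real \<Rightarrow> real) \<Rightarrow> real) \<Rightarrow> (real \<Rightarrow> real) \<Rightarrow> (real \<Rightarrow> real) \<Rightarrow> ennreal" where
  "CD_dist_sq D \<rho>0 \<rho>1 =
     (INF (\<rho>, \<psi>) \<in> {(\<rho>, \<psi>). CD_curve D \<rho>0 \<rho>1 \<rho> \<psi>}.
        \<integral>\<^sup>+t\<in>{0..1}. (\<integral>\<^sup>+x. ennreal (D x (\<rho> t) * (deriv (deriv (\<psi> t)) x)\<^sup>2) \<partial>lborel) \<partial>lborel)"


section \<open>The distance between Lorenz curves\<close>

text \<open>
  Since \<open>\<L>' = G[\<rho>]\<close> and \<open>\<L>'' = 1 / \<rho> \<circ> G[\<rho>]\<close>, the density with Lorenz curve \<open>\<L>\<close> takes the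
  value \<open>1 / \<L>''(f)\<close> at the point \<open>x = \<L>'(f)\<close>.  The second argument of \<open>d\<close> is the whole density,
  not just its value at \<open>x\<close>: \<open>d\<close> may be a nonlocal functional.
\<close>

definition lorenz_density :: "(real \<Rightarrow> real) \<Rightarrow> real \<Rightarrow> real" where
  "lorenz_density \<L> x = 1 / deriv (deriv \<L>) (inv_into {0<..<1} (deriv \<L>) x)"

definition lorenz_coeff ::
  "(real \<Rightarrow> (real \<Rightarrow> real) \<Rightarrow> real) \<Rightarrow> real \<Rightarrow> (real \<Rightarrow> real) \<Rightarrow> real" where
  "lorenz_coeff d f \<L> = d (deriv \<L> f) (lorenz_density \<L>)"

text \<open>\<open>\<L>'\<close> is infinite at 0 and 1, so the integral is taken over the open interval.\<close>

definition lorenz_norm_sq ::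
  "(real \<Rightarrow> (real \<Rightarrow> real) \<Rightarrow> real) \<Rightarrow> (real \<Rightarrow> real) \<Rightarrow> (real \<Rightarrow> real) \<Rightarrow> ennreal" where
  "lorenz_norm_sq d \<L> \<eta> =
     (\<integral>\<^sup>+f\<in>{0<..<1}.
        ennreal (1 / lorenz_coeff d f \<L> * (deriv (deriv \<L>) f)\<^sup>2 * (\<eta> f)\<^sup>2) \<partial>lborel)"

definition time_deriv :: "(real \<Rightarrow> real \<Rightarrow> real) \<Rightarrow> real \<Rightarrow> real \<Rightarrow> real" where
  "time_deriv \<L> t f = vector_derivative (\<lambda>s. \<L> s f) (at t within {0..1})"

text \<open>
  Smoothness in \<open>f\<close> is required on the open interval only, because \<open>\<L>'\<close> is infinite at 0 and 1,
  but the velocity is a continuous function up to the boundary.  It vanishes at \<open>f = 0\<close> because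
  every Lorenz curve does, and at \<open>f = 1\<close> by the last condition.  Likewise
  \<open>\<L>'(0) = -\<infinity>\<close> and \<open>\<L>'(1) = \<infinity>\<close> are kept along the curve because it stays in
  \<open>lorenz_curves\<close>; this is what \<open>\<eta>'(0) = \<eta>'(1) = 0\<close> formally linearises.  That condition is not
  imposed literally: it would exclude, for instance, a curve of centred Gaussians with variable
  variance.  Positivity of \<open>\<L>''\<close> says that the density \<open>1 / \<L>''\<close> in Lorenz variables is
  finite; membership in \<open>lorenz_curves\<close> alone gives it only almost everywhere.
\<close>

definition lorenz_path ::
  "(real \<Rightarrow> real) \<Rightarrow> (real \<Rightarrow> real) \<Rightarrow> (real \<Rightarrow> real \<Rightarrow> real) \<Rightarrow> bool" where
  "lorenz_path L0 L1 \<L> \<longleftrightarrow>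
     (\<forall>t\<in>{0..1}. \<L> t \<in> lorenz_curves) \<and>
     smooth2_on {0..1} {0<..<1} \<L> \<and>
     (\<forall>t\<in>{0..1}. \<forall>f\<in>{0<..<1}. 0 < deriv (deriv (\<L> t)) f) \<and>
     continuous_on ({0..1} \<times> {0..1}) (\<lambda>(t, f). time_deriv \<L> t f) \<and>
     \<L> 0 = L0 \<and> \<L> 1 = L1 \<and>
     (\<forall>t\<in>{0..1}. ((\<lambda>s. \<L> s 1) has_real_derivative 0) (at t within {0..1}))"

definition lorenz_dist_sq ::
  "(real \<Rightarrow> (real \<Rightarrow> real) \<Rightarrow> real) \<Rightarrow> (real \<Rightarrow> real) \<Rightarrow> (real \<Rightarrow> real) \<Rightarrow> ennreal" where
  "lorenz_dist_sq d L0 L1 =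
     (INF \<L> \<in> {\<L>. lorenz_path L0 L1 \<L>}.
        \<integral>\<^sup>+t\<in>{0..1}. lorenz_norm_sq d (\<L> t) (time_deriv \<L> t) \<partial>lborel)"

end

theory Submission
  imports Defs
begin

text \<open>
  For a density \<open>\<rho>\<close> with cdf \<open>C\<close> and quantile function \<open>G\<close>, let \<open>K(x) = \<integral> C\<close> over \<open>(-\<infinity>, x]\<close>.  Since
  \<open>K' = C\<close>, the Lorenz curve is the Legendre transform \<open>L(f) = f G(f) - K(G(f))\<close>, so \<open>L' = G\<close> and
  \<open>L'' = 1 / \<rho> \<circ> G\<close>.  Along a curve \<open>\<rho>\<^sub>t\<close> with flux \<open>J = D \<partial>\<^sub>x\<^sub>x \<psi>\<close>, the equation
  \<open>\<partial>\<^sub>t \<rho> = \<partial>\<^sub>x\<^sub>x J\<close> says that \<open>\<partial>\<^sub>t K\<close> and \<open>J\<close> have the same second derivative; as both vanish at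
  \<open>-\<infinity>\<close> they agree, and the envelope theorem gives \<open>\<partial>\<^sub>t L = - J \<circ> G\<close>.  This identifies the two
  families of admissible curves, and the substitution \<open>f = C(x)\<close> turns
  \<open>(1/d) (L'')\<^sup>2 (\<partial>\<^sub>t L)\<^sup>2 df\<close> into \<open>J\<^sup>2 / (d \<rho>) dx = D (\<partial>\<^sub>x\<^sub>x \<psi>)\<^sup>2 dx\<close>.
\<close>

section \<open>Calculus of \<open>Cn_on\<close> functions\<close>

text \<open>The labour lies in regularity. Curves are smooth on a closed time interval times an open
  space interval, with one-sided time derivatives at the ends, so the chain rule, the implicit
  function theorem and the symmetry of mixed partials are all needed relative to
  \<open>{0..1}\<close>. Smoothness passes from densities to Lorenz curves by solving
  \<open>C(t, G) = f\<close> for \<open>G\<close>, and back by solving \<open>L'(t, C) = x\<close>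
  for \<open>C\<close>. A Lorenz path poses a further obstacle: at each time it yields some density,
  chosen independently of the other times and determined only up to a null set, whereas
  \<open>d\<close> receives a density as a function. The density is therefore rebuilt as
  \<open>1 / L''\<close> evaluated at the cdf, and its continuity lets \<open>lorenz_density\<close>
  return it at every point. Decay of the flux at infinity corresponds to continuity of the velocity
  up to the boundary because, over the compact time interval, the cdf at a fixed point stays away
  from 0 and 1 and the quantile at a fixed level stays bounded.\<close>

declare Cn_on.simps(2) [simp del]

lemma has_real_derivative_cong_within:
  assumes "(f has_real_derivative D) (at t within T)" "t \<in> T" "\<And>s. s \<in> T \<Longrightarrow> g s = f s"
  shows "(g has_real_derivative D) (at t within T)"
  using assms unfolding has_field_derivative_def by (blast intro: has_derivative_transform)

text \<open>Names the two derivatives that \<open>Cn_on\<close> hides behind existential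
  quantifiers, so that each can carry regularity facts of its own. Their values outside
  \<open>T \<times> X\<close> stay arbitrary.\<close>

definition partials_on ::
  "real set \<Rightarrow> real set \<Rightarrow> (real \<Rightarrow> real \<Rightarrow> real) \<Rightarrow> (real \<Rightarrow> real \<Rightarrow> real) \<Rightarrow> (real \<Rightarrow> real \<Rightarrow> real) \<Rightarrow> bool"
where
  "partials_on T X u ut ux \<longleftrightarrow> (\<forall>t\<in>T. \<forall>x\<in>X.
     ((\<lambda>s. u s x) has_real_derivative ut t x) (at t within T) \<and>
     (u t has_real_derivative ux t x) (at x within X))"

lemma partials_onD:
  assumes "partials_on T X u ut ux" "t \<in> T" "x \<in> X"
  shows "((\<lambda>s. u s x) has_real_derivative ut t x) (at t within T)"
    and "(u t has_real_derivative ux t x) (at x within X)"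
  using assms by (auto simp: partials_on_def)

lemma Cn_on_Suc_partials:
  "Cn_on (Suc n) T X u \<longleftrightarrow> continuous_on (T \<times> X) (\<lambda>(t, x). u t x) \<and>
     (\<exists>ut ux. Cn_on n T X ut \<and> Cn_on n T X ux \<and> partials_on T X u ut ux)"
  by (simp add: partials_on_def Cn_on.simps)

lemma Cn_on_SucI:
  assumes "continuous_on (T \<times> X) (\<lambda>(t, x). u t x)" "Cn_on n T X ut" "Cn_on n T X ux"
    "partials_on T X u ut ux"
  shows "Cn_on (Suc n) T X u"
  using assms unfolding Cn_on_Suc_partials by blast

lemma Cn_on_SucE:
  assumes "Cn_on (Suc n) T X u"
  obtains ut ux where "Cn_on n T X ut" "Cn_on n T X ux" "partials_on T X u ut ux"
  using assms unfolding Cn_on_Suc_partials by blast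

lemma Cn_on_continuous: "Cn_on n T X u \<Longrightarrow> continuous_on (T \<times> X) (\<lambda>(t, x). u t x)"
  by (cases n) (simp_all add: Cn_on_Suc_partials)

lemma partials_on_cong:
  assumes "partials_on T X u ut ux" "\<And>t x. t \<in> T \<Longrightarrow> x \<in> X \<Longrightarrow> u t x = v t x"
    "\<And>t x. t \<in> T \<Longrightarrow> x \<in> X \<Longrightarrow> ut t x = vt t x" "\<And>t x. t \<in> T \<Longrightarrow> x \<in> X \<Longrightarrow> ux t x = vx t x"
  shows "partials_on T X v vt vx"
  unfolding partials_on_def
proof (intro ballI conjI)
  fix t x assume tx: "t \<in> T" "x \<in> X"
  show "((\<lambda>s. v s x) has_real_derivative vt t x) (at t within T)"
    using has_derivative_transform[OF tx(1), of "\<lambda>s. v s x"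
        "\<lambda>s. u s x"] partials_onD(1)[OF assms(1) tx]
      assms(2,3) tx unfolding has_field_derivative_def by simp
  show "(v t has_real_derivative vx t x) (at x within X)"
    using has_derivative_transform[OF tx(2), of "v t" "u t"] partials_onD(2)[OF assms(1) tx]
      assms(2,4) tx unfolding has_field_derivative_def by simp
qed

lemma Cn_on_cong:
  assumes "Cn_on n T X u" "\<And>t x. t \<in> T \<Longrightarrow> x \<in> X \<Longrightarrow> u t x = v t x"
  shows "Cn_on n T X v"
proof -
  have c: "continuous_on (T \<times> X) (\<lambda>(t, x). v t x)"
    by (rule continuous_on_cong[THEN iffD1, OF refl _ Cn_on_continuous[OF assms(1)]])
      (use assms(2) in auto)
  show ?thesis
  proof (cases n)
    case 0
    with c show ?thesis by simp
  next
    case (Suc m)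
    with assms(1) obtain ut ux where u: "Cn_on m T X ut" "Cn_on m T X ux" "partials_on T X u ut ux"
      by (auto elim: Cn_on_SucE)
    have "partials_on T X v ut ux"
      by (rule partials_on_cong[OF u(3)]) (use assms in auto)
    then show ?thesis
      unfolding Suc by (rule Cn_on_SucI[OF c u(1,2)])
  qed
qed

lemma Cn_on_SucD: "Cn_on (Suc n) T X u \<Longrightarrow> Cn_on n T X u"
proof (induction n arbitrary: u)
  case 0
  then show ?case by (simp add: Cn_on_Suc_partials)
next
  case (Suc n)
  from Suc.prems obtain ut ux where u: "Cn_on (Suc n) T X ut" "Cn_on (Suc n) T X ux"
      "partials_on T X u ut ux"
    by (rule Cn_on_SucE)
  show ?case
    by (rule Cn_on_SucI[OF Cn_on_continuous[OF Suc.prems] Suc.IH[OF u(1)] Suc.IH[OF u(2)] u(3)])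
qed

lemma Cn_on_add:
  assumes "Cn_on n T X u" "Cn_on n T X v"
  shows "Cn_on n T X (\<lambda>t x. u t x + v t x)"
  using assms
proof (induction n arbitrary: u v)
  case 0
  then show ?case by (auto simp: case_prod_beta intro!: continuous_intros)
next
  case (Suc n)
  obtain ut ux where u: "Cn_on n T X ut" "Cn_on n T X ux" "partials_on T X u ut ux"
    using Suc.prems(1) by (rule Cn_on_SucE)
  obtain vt vx where v: "Cn_on n T X vt" "Cn_on n T X vx" "partials_on T X v vt vx"
    using Suc.prems(2) by (rule Cn_on_SucE)
  show ?case
  proof (rule Cn_on_SucI)
    show "continuous_on (T \<times> X) (\<lambda>(t, x). u t x + v t x)"
      using Suc.prems[THEN Cn_on_continuous]
      by (auto simp: case_prod_beta intro!: continuous_intros)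
    show "partials_on T X (\<lambda>t x. u t x + v t x) (\<lambda>t x. ut t x + vt t x) (\<lambda>t x. ux t x + vx t x)"
      using u(3) v(3) unfolding partials_on_def by (auto intro!: derivative_intros)
  qed (use u v Suc.IH in auto)
qed

lemma Cn_on_mult:
  assumes "Cn_on n T X u" "Cn_on n T X v"
  shows "Cn_on n T X (\<lambda>t x. u t x * v t x)"
  using assms
proof (induction n arbitrary: u v)
  case 0
  then show ?case by (auto simp: case_prod_beta intro!: continuous_intros)
next
  case (Suc n)
  obtain ut ux where u: "Cn_on n T X ut" "Cn_on n T X ux" "partials_on T X u ut ux"
    using Suc.prems(1) by (rule Cn_on_SucE)
  obtain vt vx where v: "Cn_on n T X vt" "Cn_on n T X vx" "partials_on T X v vt vx"
    using Suc.prems(2) by (rule Cn_on_SucE)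
  \<comment> \<open>The product rule multiplies partials, known at order \<open>n\<close>, by the
    factors themselves, which are therefore lowered from order \<open>Suc n\<close>.\<close>
  have uv: "Cn_on n T X u" "Cn_on n T X v"
    using Suc.prems by (auto dest: Cn_on_SucD)
  show ?case
  proof (rule Cn_on_SucI)
    show "continuous_on (T \<times> X) (\<lambda>(t, x). u t x * v t x)"
      using Suc.prems[THEN Cn_on_continuous]
      by (auto simp: case_prod_beta intro!: continuous_intros)
    show "partials_on T X (\<lambda>t x. u t x * v t x)
        (\<lambda>t x. ut t x * v t x + u t x * vt t x) (\<lambda>t x. ux t x * v t x + u t x * vx t x)"
      using u(3) v(3) unfolding partials_on_def by (auto intro!: derivative_eq_intros)
  qed (use u v uv Suc.IH in \<open>auto intro!: Cn_on_add\<close>)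
qed

lemma Cn_on_const: "Cn_on n T X (\<lambda>t x. c)"
proof (induction n arbitrary: c)
  case (Suc n)
  show ?case
    by (rule Cn_on_SucI[OF _ Suc[of 0] Suc[of 0]]) (auto simp: partials_on_def case_prod_beta)
qed (auto simp: case_prod_beta)

lemma Cn_on_minus:
  assumes "Cn_on n T X u"
  shows "Cn_on n T X (\<lambda>t x. - u t x)"
  using Cn_on_mult[OF Cn_on_const[of n T X "-1"] assms] by simp

lemma Cn_on_inverse:
  assumes "Cn_on n T X u" "\<And>t x. t \<in> T \<Longrightarrow> x \<in> X \<Longrightarrow> u t x \<noteq> 0"
  shows "Cn_on n T X (\<lambda>t x. inverse (u t x))"
  using assms(1)
proof (induction n)
  case 0
  then show ?case using assms(2) by (auto simp: case_prod_beta intro!: continuous_intros)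
next
  case (Suc n)
  obtain ut ux where u: "Cn_on n T X ut" "Cn_on n T X ux" "partials_on T X u ut ux"
    using Suc.prems(1) by (rule Cn_on_SucE)
  have inv: "Cn_on n T X (\<lambda>t x. inverse (u t x))"
    using Suc Cn_on_SucD by blast
  show ?case
  proof (rule Cn_on_SucI)
    show "continuous_on (T \<times> X) (\<lambda>(t, x). inverse (u t x))"
      using Suc.prems[THEN Cn_on_continuous] assms(2)
      by (auto simp: case_prod_beta intro!: continuous_intros)
    show "partials_on T X (\<lambda>t x. inverse (u t x))
        (\<lambda>t x. - (inverse (u t x) * ut t x * inverse (u t x)))
        (\<lambda>t x. - (inverse (u t x) * ux t x * inverse (u t x)))"
      unfolding partials_on_def
      using partials_onD[OF u(3)] assms(2) by (auto intro!: DERIV_inverse')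
  qed (use u inv in \<open>auto intro!: Cn_on_minus Cn_on_mult\<close>)
qed

section \<open>Total derivatives and chain rules\<close>

text \<open>A mean value estimate is made in the space direction only: there the partial is
  continuous and \<open>Y\<close> convex, while the time partial enters at the base point alone.
  Hence \<open>T\<close> may be a closed interval, end points included.\<close>

lemma total_derivative:
  assumes u: "partials_on T Y u ut uy" and uy: "continuous_on (T \<times> Y) (\<lambda>(t, y). uy t y)"
    and Y: "convex Y" and t: "t \<in> T" and y: "y \<in> Y"
  shows "((\<lambda>(t, y). u t y) has_derivative (\<lambda>(\<tau>, \<eta>). ut t y * \<tau> + uy t y * \<eta>))
      (at (t, y) within T \<times> Y)"
proof -
  have "((\<lambda>(t, y). u t y) has_derivative
      (\<lambda>(\<tau>, \<eta>). ut t y * \<tau> + blinfun_apply (blinfun_mult_right (uy t y)) \<eta>))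
          (at (t, y) within T \<times> Y)"
  proof (rule has_derivative_partialsI)
    show "((\<lambda>t. u t y) has_derivative (\<lambda>\<tau>. ut t y * \<tau>)) (at t within T)"
      using partials_onD(1)[OF u t y] by (simp add: has_field_derivative_def)
    show "(u t has_derivative blinfun_apply (blinfun_mult_right (uy t y))) (at y within Y)"
      if "t \<in> T" "y \<in> Y" for t y
      using partials_onD(2)[OF u that] by (simp add: has_field_derivative_def)
    have "continuous_on (T \<times> Y) (\<lambda>(t, y). blinfun_mult_right (uy t y))"
      using uy by (auto simp: case_prod_beta intro!: continuous_intros
          bounded_linear.continuous_on[OF bounded_linear_blinfun_mult_right])
    then show "continuous (at (t, y) within T \<times> Y) (\<lambda>(t, y). blinfun_mult_right (uy t y))"
      using t y by (auto simp: continuous_on_eq_continuous_within)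
  qed (use t y Y in auto)
  then show ?thesis by simp
qed

lemma continuous_on_partials:
  assumes u: "partials_on T Y u ut uy" and uy: "continuous_on (T \<times> Y) (\<lambda>(t, y). uy t y)"
    and Y: "convex Y"
  shows "continuous_on (T \<times> Y) (\<lambda>(t, y). u t y)"
  unfolding continuous_on_eq_continuous_within
  using total_derivative[OF assms] has_derivative_continuous by fast

text \<open>The graph of \<open>g\<close> stays in \<open>T \<times> Y\<close>, so the total
  derivative restricts to it. This is the form in which the envelope theorem is computed
  later.\<close>

lemma chain_rule_curve:
  assumes u: "partials_on T Y u ut uy" and uy: "continuous_on (T \<times> Y) (\<lambda>(t, y). uy t y)"
    and Y: "convex Y" and t: "t \<in> T" and g: "(g has_real_derivative g') (at t within T)"
    and gY: "\<And>s. s \<in> T \<Longrightarrow> g s \<in> Y"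
  shows "((\<lambda>s. u s (g s)) has_real_derivative ut t (g t) + uy t (g t) * g') (at t within T)"
proof -
  have 1: "((\<lambda>s. (s, g s)) has_derivative (\<lambda>h. (h, g' * h))) (at t within T)"
    using g by (auto simp: has_field_derivative_def intro!: derivative_eq_intros)
  have "((\<lambda>(t, y). u t y) has_derivative (\<lambda>(\<tau>, \<eta>). ut t (g t) * \<tau> + uy t (g t) * \<eta>))
      (at (t, g t) within (\<lambda>s. (s, g s)) ` T)"
    by (rule has_derivative_subset[OF total_derivative[OF u uy Y t gY[OF t]]]) (use gY in auto)
  from has_derivative_in_compose[OF 1 this]
  have "((\<lambda>s. u s (g s)) has_derivative (\<lambda>h. ut t (g t) * h + uy t (g t) * (g' * h)))
      (at t within T)"
    by simp
  then show ?thesis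
    unfolding has_field_derivative_def
    by (rule has_derivative_eq_rhs) (auto simp: algebra_simps)
qed

lemma partials_on_compose:
  assumes u: "partials_on T Y u ut uy" and uy: "continuous_on (T \<times> Y) (\<lambda>(t, y). uy t y)"
    and Y: "convex Y" and g: "partials_on T X g gt gx"
    and gY: "\<And>t x. t \<in> T \<Longrightarrow> x \<in> X \<Longrightarrow> g t x \<in> Y"
  shows "partials_on T X (\<lambda>t x. u t (g t x))
    (\<lambda>t x. ut t (g t x) + uy t (g t x) * gt t x) (\<lambda>t x. uy t (g t x) * gx t x)"
  unfolding partials_on_def
proof (intro ballI conjI)
  fix t x assume tx: "t \<in> T" "x \<in> X"
  show "((\<lambda>s. u s (g s x)) has_real_derivative ut t (g t x) + uy t (g t x) * gt t x)
      (at t within T)"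
    by (rule chain_rule_curve[OF u uy Y tx(1) partials_onD(1)[OF g tx]]) (use gY tx in auto)
  show "((\<lambda>x. u t (g t x)) has_real_derivative uy t (g t x) * gx t x) (at x within X)"
    by (rule DERIV_image_chain[where f="u t", OF _ partials_onD(2)[OF g tx], unfolded o_def])
      (use gY tx in \<open>auto intro!: DERIV_subset[OF partials_onD(2)[OF u]]\<close>)
qed

text \<open>Both partials of the composite are built from \<open>ut\<close> and \<open>ux\<close>
  composed with the same \<open>g\<close>, and from partials of \<open>g\<close>. The induction
  therefore generalises over \<open>u\<close> and keeps \<open>g\<close> fixed.\<close>

lemma Cn_on_compose:
  assumes "Cn_on n T Y u" "Cn_on n T X g" "convex Y" "\<And>t x. t \<in> T \<Longrightarrow> x \<in> X \<Longrightarrow> g t x \<in> Y"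
  shows "Cn_on n T X (\<lambda>t x. u t (g t x))"
  using assms(1,2)
proof (induction n arbitrary: u)
  have cont: "continuous_on (T \<times> X) (\<lambda>(t, x). u t (g t x))"
    if "continuous_on (T \<times> Y) (\<lambda>(t, y). u t y)" "continuous_on (T \<times> X) (\<lambda>(t, x). g t x)" for u
  proof -
    have "continuous_on (T \<times> X) (\<lambda>p. (fst p, g (fst p) (snd p)))"
      using that(2) by (auto simp: case_prod_beta intro!: continuous_intros)
    from continuous_on_compose2[OF that(1) this] show ?thesis
      using assms(4) by (auto simp: case_prod_beta image_subset_iff)
  qed
  {
    case 0
    then show ?case using cont by simp
  next
    case (Suc n)
    obtain ut ux where u: "Cn_on n T Y ut" "Cn_on n T Y ux" "partials_on T Y u ut ux"
      using Suc.prems(1) by (rule Cn_on_SucE)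
    obtain gt gx where g: "Cn_on n T X gt" "Cn_on n T X gx" "partials_on T X g gt gx"
      using Suc.prems(2) by (rule Cn_on_SucE)
    have gn: "Cn_on n T X g" using Suc.prems(2) by (rule Cn_on_SucD)
    show ?case
    proof (rule Cn_on_SucI)
      show "continuous_on (T \<times> X) (\<lambda>(t, x). u t (g t x))"
        by (rule cont[OF Suc.prems[THEN Cn_on_continuous]])
      show "partials_on T X (\<lambda>t x. u t (g t x))
          (\<lambda>t x. ut t (g t x) + ux t (g t x) * gt t x) (\<lambda>t x. ux t (g t x) * gx t x)"
        by (rule partials_on_compose[OF u(3) Cn_on_continuous[OF u(2)] assms(3) g(3) assms(4)])
    qed (use u g gn Suc.IH in \<open>auto intro!: Cn_on_add Cn_on_mult\<close>)
  }
qed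

section \<open>Smooth functions of time and space\<close>

lemma smooth2_onD: "smooth2_on T X u \<Longrightarrow> Cn_on n T X u"
  by (simp add: smooth2_on_def)

lemma smooth2_on_continuous: "smooth2_on T X u \<Longrightarrow> continuous_on (T \<times> X) (\<lambda>(t, x). u t x)"
  using smooth2_onD Cn_on_continuous by blast

lemma smooth2_on_cong:
  assumes "smooth2_on T X u" "\<And>t x. t \<in> T \<Longrightarrow> x \<in> X \<Longrightarrow> u t x = v t x"
  shows "smooth2_on T X v"
  using assms Cn_on_cong unfolding smooth2_on_def by blast

lemma smooth2_on_minus: "smooth2_on T X u \<Longrightarrow> smooth2_on T X (\<lambda>t x. - u t x)"
  unfolding smooth2_on_def by (blast intro: Cn_on_minus)

lemma smooth2_on_inverse:
  assumes "smooth2_on T X u" "\<And>t x. t \<in> T \<Longrightarrow> x \<in> X \<Longrightarrow> u t x \<noteq> 0"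
  shows "smooth2_on T X (\<lambda>t x. inverse (u t x))"
  using assms unfolding smooth2_on_def by (blast intro: Cn_on_inverse)

lemma smooth2_on_compose:
  assumes "smooth2_on T Y u" "smooth2_on T X g" "convex Y" "\<And>t x. t \<in> T \<Longrightarrow> x \<in> X \<Longrightarrow> g t x \<in> Y"
  shows "smooth2_on T X (\<lambda>t x. u t (g t x))"
  using assms unfolding smooth2_on_def by (blast intro: Cn_on_compose)

text \<open>Continuity of \<open>u\<close> comes from its total derivative, so smoothness can be
  read off from a formula for the two partials.\<close>

lemma smooth2_onI:
  assumes "smooth2_on T X ut" "smooth2_on T X ux" "partials_on T X u ut ux" "convex X"
  shows "smooth2_on T X u"
  unfolding smooth2_on_def
proof
  fix n
  have c: "continuous_on (T \<times> X) (\<lambda>(t, x). u t x)"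
    by (rule continuous_on_partials[OF assms(3) smooth2_on_continuous[OF assms(2)] assms(4)])
  show "Cn_on n T X u"
  proof (cases n)
    case (Suc m)
    show ?thesis
      unfolding Suc by (rule Cn_on_SucI[OF c _ _ assms(3)]) (simp_all add: assms smooth2_onD)
  qed (use c in simp)
qed

lemma real_derivative_unique_within:
  assumes "(f has_real_derivative a) (at x within S)" "(f has_real_derivative b) (at x within S)"
    and "at x within S \<noteq> bot"
  shows "a = b"
  using assms vector_derivative_unique_within
  unfolding has_real_derivative_iff_has_vector_derivative by blast

text \<open>\<open>Cn_on\<close> supplies a possibly different pair of partials at every order.
  Derivatives are unique at limit points, so all these pairs agree on \<open>T \<times> X\<close>,
  and a single pair inherits every order.\<close>

lemma smooth2_on_partials:
  assumes u: "smooth2_on T X u" and T: "\<And>t. t \<in> T \<Longrightarrow> at t within T \<noteq> bot"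
    and X: "\<And>x. x \<in> X \<Longrightarrow> at x within X \<noteq> bot"
  obtains ut ux where "smooth2_on T X ut" "smooth2_on T X ux" "partials_on T X u ut ux"
proof -
  obtain ut ux where p: "partials_on T X u ut ux"
    using smooth2_onD[OF u, of "Suc 0"] by (rule Cn_on_SucE)
  have "Cn_on n T X ut \<and> Cn_on n T X ux" for n
  proof -
    obtain vt vx where v: "Cn_on n T X vt" "Cn_on n T X vx" "partials_on T X u vt vx"
      using smooth2_onD[OF u, of "Suc n"] by (rule Cn_on_SucE)
    have "vt t x = ut t x" "vx t x = ux t x" if "t \<in> T" "x \<in> X" for t x
      using real_derivative_unique_within[OF partials_onD(1)[OF v(3) that] partials_onD(1)[OF p
          that]]
       real_derivative_unique_within[OF partials_onD(2)[OF v(3) that] partials_onD(2)[OF p that]]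
           T X that
      by auto
    with Cn_on_cong v show ?thesis by blast
  qed
  then show ?thesis using p by (intro that[of ut ux]) (simp_all add: smooth2_on_def)
qed

section \<open>Inverse functions depending on a parameter\<close>

text \<open>To keep \<open>g\<close> above \<open>a\<close> near \<open>(t0, x0)\<close>, choose
  \<open>y\<close> in the open set \<open>Y\<close> between \<open>a\<close> and
  \<open>g t0 x0\<close>. The strict inequality \<open>F t0 y < x0\<close> persists nearby, since
  only \<open>F\<close> at the fixed point \<open>y\<close> has to vary continuously, and
  monotonicity turns it back into a bound on \<open>g\<close>. The upper bound is symmetric.\<close>

lemma continuous_on_inverse_function:
  fixes F g :: "real \<Rightarrow> real \<Rightarrow> real"
  assumes F: "\<And>y. y \<in> Y \<Longrightarrow> continuous_on T (\<lambda>t. F t y)"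
    and mono: "\<And>t. t \<in> T \<Longrightarrow> strict_mono_on Y (F t)" and Y: "open Y"
    and gY: "\<And>t x. t \<in> T \<Longrightarrow> x \<in> X \<Longrightarrow> g t x \<in> Y"
    and Fg: "\<And>t x. t \<in> T \<Longrightarrow> x \<in> X \<Longrightarrow> F t (g t x) = x"
  shows "continuous_on (T \<times> X) (\<lambda>(t, x). g t x)"
  unfolding continuous_on_def
proof (intro ballI)
  fix p assume p: "p \<in> T \<times> X"
  define t0 x0 where "t0 = fst p" and "x0 = snd p"
  have p': "p = (t0, x0)" "t0 \<in> T" "x0 \<in> X" using p by (auto simp: t0_def x0_def)
  have ev: "\<forall>\<^sub>F q in at p within T \<times> X. q \<in> T \<times> X"
    by (simp add: eventually_at_filter)
  have lim: "((\<lambda>q. snd q - F (fst q) y) \<longlongrightarrow> x0 - F t0 y) (at p within T \<times> X)" if "y \<in> Y" for y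
  proof -
    have "continuous_on (T \<times> X) (\<lambda>q. snd q - F (fst q) y)"
      by (intro continuous_intros continuous_on_compose2[OF F[OF that]]) auto
    then show ?thesis using p p' by (auto simp: continuous_on_def)
  qed
  show "((\<lambda>(t, x). g t x) \<longlongrightarrow> (case p of (t, x) \<Rightarrow> g t x)) (at p within T \<times> X)"
  proof (rule order_tendstoI)
    fix a assume "a < (case p of (t, x) \<Rightarrow> g t x)"
    then have "a < g t0 x0" using p' by simp
    then obtain y where y: "y \<in> Y" "a < y" "y < g t0 x0"
    proof -
      obtain b where b: "b < g t0 x0" "{b<..g t0 x0} \<subseteq> Y"
        using open_left[OF Y gY[OF p'(2,3)]] lt_ex by blast
      have "max a b < g t0 x0" using \<open>a < g t0 x0\<close> b by simp
      from dense[OF this] obtain y where "max a b < y" "y < g t0 x0" by blast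
      with b(2) show thesis by (intro that[of y]) auto
    qed
    have "F t0 y < x0"
      using strict_mono_onD[OF mono[OF p'(2)] y(1) gY[OF p'(2,3)] y(3)] Fg p' by simp
    then have "\<forall>\<^sub>F q in at p within T \<times> X. 0 < snd q - F (fst q) y"
      using order_tendstoD(1)[OF lim[OF y(1)], of 0] by simp
    with ev show "\<forall>\<^sub>F q in at p within T \<times> X. a < (case q of (t, x) \<Rightarrow> g t x)"
    proof eventually_elim
      case (elim q)
      then have q: "fst q \<in> T" "snd q \<in> X" by auto
      have "\<not> g (fst q) (snd q) \<le> y"
        using strict_mono_on_leD[OF mono[OF q(1)] gY[OF q] y(1)] Fg[OF q] elim by fastforce
      then show ?case using y by (auto simp: case_prod_beta)
    qed
  next
    fix a assume "(case p of (t, x) \<Rightarrow> g t x) < a"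
    then have "g t0 x0 < a" using p' by simp
    then obtain y where y: "y \<in> Y" "y < a" "g t0 x0 < y"
    proof -
      obtain b where b: "g t0 x0 < b" "{g t0 x0..<b} \<subseteq> Y"
        using open_right[OF Y gY[OF p'(2,3)]] gt_ex by blast
      have "g t0 x0 < min a b" using \<open>g t0 x0 < a\<close> b by simp
      from dense[OF this] obtain y where "g t0 x0 < y" "y < min a b" by blast
      with b(2) show thesis by (intro that[of y]) auto
    qed
    have "x0 < F t0 y"
      using strict_mono_onD[OF mono[OF p'(2)] gY[OF p'(2,3)] y(1) y(3)] Fg p' by simp
    then have "\<forall>\<^sub>F q in at p within T \<times> X. snd q - F (fst q) y < 0"
      using order_tendstoD(2)[OF lim[OF y(1)], of 0] by simp
    with ev show "\<forall>\<^sub>F q in at p within T \<times> X. (case q of (t, x) \<Rightarrow> g t x) < a"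
    proof eventually_elim
      case (elim q)
      then have q: "fst q \<in> T" "snd q \<in> X" by auto
      have "\<not> y \<le> g (fst q) (snd q)"
        using strict_mono_on_leD[OF mono[OF q(1)] y(1) gY[OF q]] Fg[OF q] elim by fastforce
      then show ?case using y by (auto simp: case_prod_beta)
    qed
  qed
qed

lemma strict_mono_on_pos_deriv:
  fixes f :: "real \<Rightarrow> real"
  assumes "convex Y" "\<And>y. y \<in> Y \<Longrightarrow> (f has_real_derivative f' y) (at y within Y)"
      "\<And>y. y \<in> Y \<Longrightarrow> 0 < f' y"
  shows "strict_mono_on Y f"
proof (rule strict_mono_onI)
  fix r s assume rs: "r \<in> Y" "s \<in> Y" "r < s"
  have sub: "{r..s} \<subseteq> Y"
    using assms(1) rs by (metis closed_segment_eq_real_ivl closed_segment_subset less_imp_le)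
  show "f r < f s"
  proof (rule DERIV_pos_imp_increasing_open[OF rs(3)])
    show "continuous_on {r..s} f"
      by (rule DERIV_continuous_on[where D=f']) (use sub
          in \<open>auto intro!: DERIV_subset[OF assms(2) sub]\<close>)
    show "\<exists>y. (f has_real_derivative y) (at x) \<and> 0 < y" if "r < x" "x < s" for x
    proof -
      have "x \<in> interior Y"
        using that by (intro interiorI[of "{r<..<s}"]) (use sub in auto)
      then have "x \<in> Y" "at x within Y = at x"
        using interior_subset at_within_interior by auto
      with assms(2,3)[of x] show ?thesis by auto
    qed
  qed
qed

text \<open>The map \<open>\<Phi>(t, y) = (t, F t y)\<close> has the inverse
  \<open>\<Psi>(t, x) = (t, g t x)\<close>, already known to be continuous. Its derivative is
  triangular with diagonal entries 1 and \<open>Fy\<close>, so it is inverted by hand. Derivatives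
  relative to \<open>T \<times> Y\<close> are kept throughout because \<open>T\<close> need not be
  open.\<close>

lemma partials_on_inverse_function:
  assumes F: "partials_on T Y F Ft Fy" and Fy: "continuous_on (T \<times> Y) (\<lambda>(t, y). Fy t y)"
    and pos: "\<And>t y. t \<in> T \<Longrightarrow> y \<in> Y \<Longrightarrow> 0 < Fy t y" and Y: "convex Y" "open Y"
    and FX: "\<And>t. t \<in> T \<Longrightarrow> F t ` Y = X"
    and gY: "\<And>t x. t \<in> T \<Longrightarrow> x \<in> X \<Longrightarrow> g t x \<in> Y"
    and Fg: "\<And>t x. t \<in> T \<Longrightarrow> x \<in> X \<Longrightarrow> F t (g t x) = x"
  shows "continuous_on (T \<times> X) (\<lambda>(t, x). g t x)"
    and "partials_on T X g (\<lambda>t x. - (Ft t (g t x) * inverse (Fy t (g t x)))) (\<lambda>t x. inverse (Fy t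
        (g t x)))"
proof -
  have mono: "strict_mono_on Y (F t)" if "t \<in> T" for t
    using strict_mono_on_pos_deriv[OF Y(1) partials_onD(2)[OF F that] pos[OF that]] .
  have Fcont: "continuous_on T (\<lambda>t. F t y)" if "y \<in> Y" for y
    using partials_onD(1)[OF F _ that] by (rule DERIV_continuous_on)
  show g: "continuous_on (T \<times> X) (\<lambda>(t, x). g t x)"
    by (rule continuous_on_inverse_function[OF Fcont mono Y(2) gY Fg])
  have gF: "g t (F t y) = y" if "t \<in> T" "y \<in> Y" for t y
    by (rule inj_onD[OF strict_mono_on_imp_inj_on[OF mono[OF that(1)]]])
      (use that FX[OF that(1)] gY[OF that(1)] Fg[OF that(1)] in auto)
  show "partials_on T X g (\<lambda>t x. - (Ft t (g t x) * inverse (Fy t (g t x)))) (\<lambda>t x. inverse (Fy t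
      (g t x)))"
    unfolding partials_on_def
  proof (intro ballI)
    fix t x assume tx: "t \<in> T" "x \<in> X"
    define y where "y = g t x"
    have y: "y \<in> Y" "F t y = x" using tx gY Fg by (auto simp: y_def)
    define \<Phi> where "\<Phi> = (\<lambda>(t, y). (t, F t y))"
    define \<Psi> where "\<Psi> = (\<lambda>(t, x). (t, g t x))"
    define \<Phi>' where "\<Phi>' = (\<lambda>(\<tau>::real, \<eta>). (\<tau>, Ft t y * \<tau> + Fy t y * \<eta>))"
    define \<Psi>' where "\<Psi>' = (\<lambda>(\<tau>::real, \<xi>). (\<tau>, (\<xi> - Ft t y * \<tau>) * inverse (Fy t y)))"
    have nz: "Fy t y \<noteq> 0" using pos[OF tx(1) y(1)] by simp
    have im: "\<Phi> ` (T \<times> Y) = T \<times> X"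
      using FX by (fastforce simp: \<Phi>_def image_iff)
    have "(\<Phi> has_derivative \<Phi>') (at (t, y) within T \<times> Y)"
      using has_derivative_Pair[OF has_derivative_fst[OF has_derivative_ident]
          total_derivative[OF F Fy Y(1) tx(1) y(1)]]
      by (simp add: \<Phi>_def \<Phi>'_def case_prod_unfold)
    then have "(\<Psi> has_derivative \<Psi>') (at (\<Phi> (t, y)) within \<Phi> ` (T \<times> Y))"
    proof (rule has_derivative_inverse_within)
      have "continuous_on (T \<times> X) \<Psi>"
        using g unfolding \<Psi>_def case_prod_unfold by (intro continuous_intros)
      then show "continuous (at (\<Phi> (t, y)) within \<Phi> ` (T \<times> Y)) \<Psi>"
        using tx y unfolding im by (simp add: continuous_on_eq_continuous_within \<Phi>_def)
      show "linear \<Psi>'"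
        by (rule linearI) (auto simp: \<Psi>'_def algebra_simps)
      show "\<Psi>' \<circ> \<Phi>' = id"
        using nz by (auto simp: \<Psi>'_def \<Phi>'_def fun_eq_iff field_simps)
    qed (use gF tx y in \<open>auto simp: \<Phi>_def \<Psi>_def\<close>)
    then have \<Psi>: "(\<Psi> has_derivative \<Psi>') (at (t, x) within T \<times> X)"
      using y unfolding im by (simp add: \<Phi>_def)
    have g': "((\<lambda>p. g (fst p) (snd p)) has_derivative (\<lambda>(\<tau>, \<xi>). (\<xi> - Ft t y * \<tau>) * inverse (Fy t
        y))) (at (t, x) within T \<times> X)"
      using has_derivative_snd[OF \<Psi>] by (simp add: \<Psi>_def \<Psi>'_def case_prod_unfold)
    show "((\<lambda>s. g s x) has_real_derivative - (Ft t (g t x) * inverse (Fy t (g t x))))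
        (at t within T) \<and>
        (g t has_real_derivative inverse (Fy t (g t x))) (at x within X)"
    proof
      have "((\<lambda>s. (s, x)) has_derivative (\<lambda>h. (h, 0))) (at t within T)"
        by (auto intro!: derivative_eq_intros)
      from has_derivative_in_compose[OF this has_derivative_subset[OF g', of "(\<lambda>s. (s, x)) ` T"]]
      have "((\<lambda>s. g s x) has_derivative (\<lambda>h. (0 - Ft t y * h) * inverse (Fy t y))) (at t within T)"
        using tx by auto
      then show "((\<lambda>s. g s x) has_real_derivative - (Ft t (g t x) * inverse (Fy t (g t x))))
          (at t within T)"
        unfolding has_field_derivative_def by (rule has_derivative_eq_rhs) (auto simp: y_def)
      have "((\<lambda>x. (t, x)) has_derivative (\<lambda>h. (0, h))) (at x within X)"
        by (auto intro!: derivative_eq_intros)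
      from has_derivative_in_compose[OF this has_derivative_subset[OF g', of "(\<lambda>x. (t, x)) ` X"]]
      have "(g t has_derivative (\<lambda>h. (h - Ft t y * 0) * inverse (Fy t y))) (at x within X)"
        using tx by auto
      then show "(g t has_real_derivative inverse (Fy t (g t x))) (at x within X)"
        unfolding has_field_derivative_def by (rule has_derivative_eq_rhs) (auto simp: y_def)
    qed
  qed
qed

text \<open>Bootstrapping: the partials of \<open>g\<close> are algebraic expressions in smooth
  functions composed with \<open>g\<close>, so order \<open>n\<close> for \<open>g\<close> gives
  order \<open>n\<close> for its partials, hence order \<open>Suc n\<close> for
  \<open>g\<close>.\<close>

lemma smooth2_on_inverse_function:
  assumes F: "partials_on T Y F Ft Fy" and s: "smooth2_on T Y Ft" "smooth2_on T Y Fy"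
    and pos: "\<And>t y. t \<in> T \<Longrightarrow> y \<in> Y \<Longrightarrow> 0 < Fy t y" and Y: "convex Y" "open Y"
    and FX: "\<And>t. t \<in> T \<Longrightarrow> F t ` Y = X"
    and gY: "\<And>t x. t \<in> T \<Longrightarrow> x \<in> X \<Longrightarrow> g t x \<in> Y"
    and Fg: "\<And>t x. t \<in> T \<Longrightarrow> x \<in> X \<Longrightarrow> F t (g t x) = x"
  shows "smooth2_on T X g"
  unfolding smooth2_on_def
proof
  fix n
  note g = partials_on_inverse_function[OF F smooth2_on_continuous[OF s(2)] pos Y FX gY Fg]
  show "Cn_on n T X g"
  proof (induction n)
    case 0
    show ?case using g(1) by simp
  next
    case (Suc n)
    have comp: "Cn_on n T X (\<lambda>t x. u t (g t x))" if "smooth2_on T Y u" for u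
      by (rule Cn_on_compose[OF smooth2_onD[OF that] Suc Y(1) gY])
    have inv: "Cn_on n T X (\<lambda>t x. inverse (Fy t (g t x)))"
      by (rule Cn_on_inverse[OF comp[OF s(2)]]) (use pos gY
          in \<open>auto simp: order.strict_implies_not_eq[symmetric]\<close>)
    show ?case
      by (rule Cn_on_SucI[OF g(1) Cn_on_minus[OF Cn_on_mult[OF comp[OF s(1)] inv]] inv g(2)])
  qed
qed

section \<open>Integrals in time and exchange of derivatives\<close>

lemma continuous_on_slice:
  assumes "continuous_on (T \<times> X) (\<lambda>(t, x). u t x)"
  shows "x \<in> X \<Longrightarrow> continuous_on T (\<lambda>t. u t x)" and "t \<in> T \<Longrightarrow> continuous_on X (u t)"
  by (rule continuous_on_compose2[OF assms, of _ "\<lambda>t. (t, x)", simplified];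
      auto intro!: continuous_intros)
     (rule continuous_on_compose2[OF assms, of _ "\<lambda>x. (t, x)", simplified];
      auto intro!: continuous_intros)

lemma has_derivative_time_integral:
  fixes a b t :: real
  assumes u: "continuous_on ({a..b} \<times> X) (\<lambda>(t, x). u t x)"
    and ux: "continuous_on ({a..b} \<times> X) (\<lambda>(t, x). ux t x)"
    and d: "\<And>t x. t \<in> {a..b} \<Longrightarrow> x \<in> X \<Longrightarrow> (u t has_real_derivative ux t x) (at x within X)"
    and X: "convex X" "x \<in> X" and t: "t \<in> {a..b}"
  shows "((\<lambda>x. integral {a..t} (\<lambda>s. u s x)) has_real_derivative integral {a..t} (\<lambda>s. ux s x))
      (at x within X)"
proof -
  have sub: "{a..t} \<subseteq> {a..b}" using t by auto
  have 1: "(\<lambda>s. u s x) integrable_on cbox a t" if "x \<in> X" for x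
    unfolding cbox_interval
    by (rule integrable_continuous_real[OF continuous_on_subset[OF continuous_on_slice(1)[OF u
        that] sub]])
  have "continuous_on (X \<times> {a..t}) (\<lambda>p. case (snd p, fst p) of (t, x) \<Rightarrow> ux t x)"
    by (rule continuous_on_compose2[OF ux]) (use sub in \<open>auto intro!: continuous_intros\<close>)
  then have 2: "continuous_on (X \<times> cbox a t) (\<lambda>(x, s). ux s x)"
    by (simp add: case_prod_unfold cbox_interval)
  show ?thesis
    using leibniz_rule_field_derivative[of X a t "\<lambda>x s. u s x"
        "\<lambda>x s. ux s x", OF _ 1 2 X(2,1)] d sub
    by (auto simp: cbox_interval)
qed

lemma time_integral_of_derivative:
  assumes "\<And>t. t \<in> {a..b} \<Longrightarrow> (v has_real_derivative v' t) (at t within {a..b})" "t \<in> {a..b}"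
  shows "v t = v a + integral {a..t} v'"
proof -
  have "(v' has_integral v t - v a) {a..t}"
  proof (rule fundamental_theorem_of_calculus)
    show "(v has_vector_derivative v' s) (at s within {a..t})" if "s \<in> {a..t}" for s
      unfolding has_real_derivative_iff_has_vector_derivative[symmetric]
      using that assms by (intro DERIV_subset[OF assms(1)]) auto
  qed (use assms in auto)
  then show ?thesis by (simp add: integral_unique)
qed

text \<open>
  Schwarz' theorem up to the end points in time: differentiate \<open>u(s) = u(a) + \<integral> u\<^sub>t\<close> in space under
  the integral, and then in time.
\<close>

lemma mixed_partials:
  assumes u: "partials_on {a..b} X u ut ux" and ut: "partials_on {a..b} X ut utt utx"
    and cont: "continuous_on ({a..b} \<times> X) (\<lambda>(t, x). ut t x)"
        "continuous_on ({a..b} \<times> X) (\<lambda>(t, x). utx t x)"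
    and X: "convex X" "open X" and t: "t \<in> {a..b}" and x: "x \<in> X"
  shows "((\<lambda>s. ux s x) has_real_derivative utx t x) (at t within {a..b})"
proof -
  have eq: "ux s x = ux a x + integral {a..s} (\<lambda>s. utx s x)" if s: "s \<in> {a..b}" for s
  proof -
    have a: "a \<in> {a..b}" using s by auto
    have "((\<lambda>x. u a x + integral {a..s} (\<lambda>s. ut s x)) has_real_derivative
        ux a x + integral {a..s} (\<lambda>s. utx s x)) (at x within X)"
      by (intro derivative_intros partials_onD(2)[OF u a x]
          has_derivative_time_integral[OF cont partials_onD(2)[OF ut] X(1) x s])
    moreover have "u s y = u a y + integral {a..s} (\<lambda>s. ut s y)" if "y \<in> X" for y
      by (rule time_integral_of_derivative[OF partials_onD(1)[OF u _ that] s])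
    ultimately have "(u s has_real_derivative ux a x + integral {a..s} (\<lambda>s. utx s x))
        (at x within X)"
      using has_derivative_transform[OF x, of "u s"] unfolding has_field_derivative_def by simp
    then show ?thesis
      using real_derivative_unique_within[OF partials_onD(2)[OF u s x]] at_within_open[OF x X(2)]
          by auto
  qed
  have "((\<lambda>s. ux a x + integral {a..s} (\<lambda>s. utx s x)) has_real_derivative utx t x)
      (at t within {a..b})"
    using integral_has_real_derivative[OF continuous_on_slice(1)[OF cont(2) x] t]
    by (auto intro!: derivative_eq_intros)
  then show ?thesis
    unfolding has_field_derivative_def using eq by (intro has_derivative_transform[OF t, of
        "\<lambda>s. ux s x"])
qed

section \<open>Cumulative distribution functions and Lorenz curves\<close>

lemma interval_integral_split:
  fixes f :: "real \<Rightarrow> real"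
  assumes "integrable lborel f"
  shows "(LBINT y=a..b. f y) + (LBINT y=b..c. f y) = (LBINT y=a..c. f y)"
proof (rule interval_integral_sum)
  have "set_integrable lborel A f" if "A \<in> sets borel" for A
    using that assms unfolding set_integrable_def
    by (intro integrable_mult_indicator) auto
  then show "interval_lebesgue_integrable lborel (min a (min b c)) (max a (max b c)) f"
    unfolding interval_lebesgue_integrable_def by simp
qed

lemma interval_integral_Iio_eq:
  fixes f :: "real \<Rightarrow> real"
  shows "(LBINT y=-\<infinity>..ereal x. f y) = (LINT y|lborel. indicator {..<x} y * f y)"
  by (simp add: interval_lebesgue_integral_le_eq set_lebesgue_integral_def)

lemma interval_integral_UNIV_eq:
  fixes f :: "real \<Rightarrow> real"
  shows "(LBINT y=-\<infinity>..\<infinity>. f y) = (LINT y|lborel. f y)"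
  by (simp add: interval_lebesgue_integral_le_eq set_lebesgue_integral_def)

text \<open>Dominated convergence along sequences: the indicators of \<open>{..<X n}\<close>
  converge everywhere except possibly at the limit point, a null set.\<close>

lemma isCont_interval_integral_Iio:
  fixes f :: "real \<Rightarrow> real"
  assumes f: "integrable lborel f"
  shows "isCont (\<lambda>x. LBINT y=-\<infinity>..ereal x. f y) x"
  unfolding continuous_at_sequentially interval_integral_Iio_eq o_def
proof (intro allI impI)
  fix X :: "nat \<Rightarrow> real" assume X: "X \<longlonglongrightarrow> x"
  show "(\<lambda>n. LINT y|lborel. indicator {..<X n} y * f y) \<longlonglongrightarrow> (LINT y|lborel. indicator {..<x} y * f y)"
  proof (rule integral_dominated_convergence)
    show "integrable lborel (\<lambda>y. \<bar>f y\<bar>)" using f by simp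
    show "AE y in lborel. (\<lambda>n. indicator {..<X n} y * f y) \<longlonglongrightarrow> indicator {..<x} y * f y"
      using AE_lborel_singleton[of x]
    proof eventually_elim
      case (elim y)
      have "\<forall>\<^sub>F n in sequentially. indicator {..<X n} y * f y = indicator {..<x} y * f y"
      proof (cases "y < x")
        case True
        show ?thesis
          using order_tendstoD(1)[OF X True] by eventually_elim (use True in auto)
      next
        case False
        with elim have "x < y" by simp
        from order_tendstoD(2)[OF X this] show ?thesis
          by eventually_elim (use \<open>x < y\<close> in auto)
      qed
      then show ?case by (rule tendsto_eventually)
    qed
  qed (use f in \<open>auto split: split_indicator\<close>)
qed

lemma interval_integral_Iio_tendsto:
  fixes f :: "real \<Rightarrow> real"
  assumes f: "integrable lborel f"
  shows "((\<lambda>x. LBINT y=-\<infinity>..ereal x. f y) \<longlongrightarrow> 0) at_bot"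
    and "((\<lambda>x. LBINT y=-\<infinity>..ereal x. f y) \<longlongrightarrow> (LINT y|lborel. f y)) at_top"
proof -
  \<comment> \<open>The limit at \<open>at_bot\<close> is reflected into one at
    \<open>at_top\<close>, to which dominated convergence applies.\<close>
  have "((\<lambda>t. LINT y|lborel. indicator {..<-t} y * f y) \<longlongrightarrow> integral\<^sup>L lborel (\<lambda>y::real. 0 :: real))
      at_top"
  proof (rule integral_dominated_convergence_at_top)
    show "AE y in lborel. ((\<lambda>t. indicator {..<-t} y * f y) \<longlongrightarrow> 0) at_top"
    proof (intro AE_I2 tendsto_eventually)
      fix y show "\<forall>\<^sub>F t in at_top. indicator {..<-t} y * f y = 0"
        using eventually_ge_at_top[of "-y"] by eventually_elim auto
    qed
    show "integrable lborel (\<lambda>y. \<bar>f y\<bar>)" using f by simp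
  qed (use f in \<open>auto split: split_indicator\<close>)
  then show "((\<lambda>x. LBINT y=-\<infinity>..ereal x. f y) \<longlongrightarrow> 0) at_bot"
    unfolding filterlim_at_bot_mirror interval_integral_Iio_eq by simp
  show "((\<lambda>x. LBINT y=-\<infinity>..ereal x. f y) \<longlongrightarrow> (LINT y|lborel. f y)) at_top"
    unfolding interval_integral_Iio_eq
  proof (rule integral_dominated_convergence_at_top)
    show "AE y in lborel. ((\<lambda>t. indicator {..<t} y * f y) \<longlongrightarrow> f y) at_top"
    proof (intro AE_I2 tendsto_eventually)
      fix y show "\<forall>\<^sub>F t in at_top. indicator {..<t} y * f y = f y"
        using eventually_gt_at_top[of y] by eventually_elim auto
    qed
    show "integrable lborel (\<lambda>y. \<bar>f y\<bar>)" using f by simp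
  qed (use f in \<open>auto split: split_indicator\<close>)
qed

text \<open>The fundamental theorem is applied on the bounded interval around \<open>x\<close> that
  starts at \<open>x - 1\<close>; the mass to the left of \<open>x - 1\<close> is a constant
  summand.\<close>

lemma interval_integral_Iio_has_derivative:
  fixes f :: "real \<Rightarrow> real"
  assumes f: "integrable lborel f" and cont: "continuous_on UNIV f"
  shows "((\<lambda>x. LBINT y=-\<infinity>..ereal x. f y) has_real_derivative f x) (at x)"
proof -
  have "((\<lambda>u. LBINT y=ereal (x - 1)..ereal u. f y) has_vector_derivative f x)
      (at x within {x - 1..x + 1})"
    by (rule interval_integral_FTC2) (use cont in \<open>auto intro: continuous_on_subset\<close>)
  then have "((\<lambda>u. LBINT y=ereal (x - 1)..ereal u. f y) has_real_derivative f x) (at x)"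
    by (simp add: has_real_derivative_iff_has_vector_derivative at_within_Icc_at)
  then have "((\<lambda>u. (LBINT y=-\<infinity>..ereal (x - 1). f y) + (LBINT y=ereal (x - 1)..ereal u. f y))
      has_real_derivative f x) (at x)"
    by (auto intro!: derivative_eq_intros)
  then show ?thesis
    by (simp add: interval_integral_split[OF f])
qed

lemma emeasure_density_Ioi:
  fixes h :: "real \<Rightarrow> real"
  assumes h: "integrable lborel h" "\<And>x. 0 \<le> h x"
  shows "emeasure (density lborel h) {x<..} = ennreal ((LINT y|lborel. h y) - (LBINT y=-\<infinity>..ereal
      x. h y))"
proof -
  have "emeasure (density lborel h) {x<..} = (\<integral>\<^sup>+y. ennreal (indicator {x<..} y * h y) \<partial>lborel)"
    using h by (subst emeasure_density) (auto intro!: nn_integral_cong split: split_indicator)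
  also have "\<dots> = ennreal (LINT y|lborel. indicator {x<..} y * h y)"
    using h integrable_mult_indicator[of "{x<..}" lborel h] by (intro nn_integral_eq_integral) auto
  also have "(LINT y|lborel. indicator {x<..} y * h y) = (LBINT y=ereal x..\<infinity>. h y)"
    by (simp add: interval_lebesgue_integral_le_eq set_lebesgue_integral_def)
  also have "\<dots> = (LINT y|lborel. h y) - (LBINT y=-\<infinity>..ereal x. h y)"
    using interval_integral_split[OF h(1), of "-\<infinity>" "ereal x" \<infinity>]
    unfolding interval_integral_UNIV_eq by simp
  finally show ?thesis .
qed

text \<open>The total masses agree as limits at infinity, so the two measures agree on every
  \<open>{x<..}\<close> and coincide; densities of a measure are unique almost everywhere.\<close>

lemma AE_eq_of_interval_integrals:
  fixes f g :: "real \<Rightarrow> real"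
  assumes f: "integrable lborel f" "\<And>x. 0 \<le> f x" and g: "integrable lborel g" "\<And>x. 0 \<le> g x"
    and eq: "\<And>x. (LBINT y=-\<infinity>..ereal x. f y) = (LBINT y=-\<infinity>..ereal x. g y)"
  shows "AE x in lborel. f x = g x"
proof -
  have tot: "(LINT y|lborel. f y) = (LINT y|lborel. g y)"
    using tendsto_unique[OF _ interval_integral_Iio_tendsto(2)[OF f(1)]]
        interval_integral_Iio_tendsto(2)[OF g(1)]
    by (simp add: eq)
  have "density lborel f = density lborel g"
    by (rule measure_eqI_lessThan) (auto simp: emeasure_density_Ioi f g eq tot)
  then have "AE x in lborel. ennreal (f x) = ennreal (g x)"
    using f g by (intro sigma_finite_measure.density_unique[OF
        lborel.sigma_finite_measure_axioms]) auto
  then show ?thesis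
    using f g by (auto elim!: eventually_mono)
qed

section \<open>Cdf and quantile function of a positive density\<close>

lemma pos_densitiesD:
  assumes "\<rho> \<in> pos_densities"
  shows "\<rho> \<in> borel_measurable borel" "0 < \<rho> x" "integrable lborel \<rho>" "(LINT x|lborel. \<rho> x) = 1"
    "integrable lborel (\<lambda>x. x * \<rho> x)"
  using assms by (auto simp: pos_densities_def)

abbreviation partial_moment :: "(real \<Rightarrow> real) \<Rightarrow> real \<Rightarrow> real" where
  "partial_moment \<rho> x \<equiv> LBINT y=-\<infinity>..ereal x. y * \<rho> y"

abbreviation quantile :: "(real \<Rightarrow> real) \<Rightarrow> real \<Rightarrow> real" where
  "quantile \<rho> \<equiv> inv (cum_dist \<rho>)"

text \<open>On the interval of integration the factor \<open>z\<close> lies between the end points.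
  These two bounds make Lorenz curves differentiable for densities that are merely
  measurable.\<close>

lemma partial_moment_bounds:
  assumes \<rho>: "\<rho> \<in> pos_densities" and "x \<le> y"
  shows "x * (cum_dist \<rho> y - cum_dist \<rho> x) \<le> partial_moment \<rho> y - partial_moment \<rho> x"
    and "partial_moment \<rho> y - partial_moment \<rho> x \<le> y * (cum_dist \<rho> y - cum_dist \<rho> x)"
proof -
  note d = pos_densitiesD[OF \<rho>]
  have C: "cum_dist \<rho> y - cum_dist \<rho> x = (LINT z|lborel. indicator {x<..<y} z * \<rho> z)"
    using interval_integral_split[OF d(3), of "-\<infinity>" x y] \<open>x \<le> y\<close>
    by (simp add: cum_dist_def interval_lebesgue_integral_le_eq set_lebesgue_integral_def)
  have M: "partial_moment \<rho> y - partial_moment \<rho> x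
      = (LINT z|lborel. indicator {x<..<y} z * (z * \<rho> z))"
    using interval_integral_split[OF d(5), of "-\<infinity>" x y] \<open>x \<le> y\<close>
    by (simp add: interval_lebesgue_integral_le_eq set_lebesgue_integral_def)
  have i: "integrable lborel (\<lambda>z. indicator {x<..<y} z * (z * \<rho> z))"
      "integrable lborel (\<lambda>z. c * (indicator {x<..<y} z * \<rho> z))" for c
    using integrable_mult_indicator[OF _ d(5), of "{x<..<y}"] integrable_mult_indicator[OF _ d(3),
        of "{x<..<y}"] by auto
  have "(LINT z|lborel. x * (indicator {x<..<y} z * \<rho> z))
      \<le> (LINT z|lborel. indicator {x<..<y} z * (z * \<rho> z))"
    by (rule integral_mono[OF i(2,1)]) (use d(2) in \<open>auto split: split_indicator\<close>)
  then show "x * (cum_dist \<rho> y - cum_dist \<rho> x) \<le> partial_moment \<rho> y - partial_moment \<rho> x"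
    unfolding C M by simp
  have "(LINT z|lborel. indicator {x<..<y} z * (z * \<rho> z))
      \<le> (LINT z|lborel. y * (indicator {x<..<y} z * \<rho> z))"
    by (rule integral_mono[OF i(1,2)]) (use d(2) in \<open>auto split: split_indicator\<close>)
  then show "partial_moment \<rho> y - partial_moment \<rho> x \<le> y * (cum_dist \<rho> y - cum_dist \<rho> x)"
    unfolding C M by simp
qed

lemma isCont_cum_dist: "\<rho> \<in> pos_densities \<Longrightarrow> isCont (cum_dist \<rho>) x"
  using isCont_interval_integral_Iio[OF pos_densitiesD(3)] by (simp add: cum_dist_def[abs_def])

lemma cum_dist_tendsto:
  assumes "\<rho> \<in> pos_densities"
  shows "(cum_dist \<rho> \<longlongrightarrow> 0) at_bot" "(cum_dist \<rho> \<longlongrightarrow> 1) at_top"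
  using interval_integral_Iio_tendsto[OF pos_densitiesD(3)[OF assms]] pos_densitiesD(4)[OF assms]
  by (simp_all add: cum_dist_def[abs_def])

text \<open>If the mass between \<open>x\<close> and \<open>y\<close> vanished, positivity of
  \<open>\<rho>\<close> would make a nonempty open interval a null set.\<close>

lemma strict_mono_cum_dist:
  assumes \<rho>: "\<rho> \<in> pos_densities"
  shows "strict_mono (cum_dist \<rho>)"
proof (rule strict_monoI)
  fix x y :: real assume "x < y"
  note d = pos_densitiesD[OF \<rho>]
  have C: "cum_dist \<rho> y - cum_dist \<rho> x = (LINT z|lborel. indicator {x<..<y} z * \<rho> z)"
    using interval_integral_split[OF d(3), of "-\<infinity>" x y] \<open>x < y\<close>
    by (simp add: cum_dist_def interval_lebesgue_integral_le_eq set_lebesgue_integral_def)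
  have i: "integrable lborel (\<lambda>z. indicator {x<..<y} z * \<rho> z)"
    using integrable_mult_indicator[OF _ d(3), of "{x<..<y}"] by auto
  have nn: "0 \<le> indicator {x<..<y} z * \<rho> z" for z
    using d(2)[of z] by (auto split: split_indicator)
  have "(LINT z|lborel. indicator {x<..<y} z * \<rho> z) \<noteq> 0"
  proof
    assume "(LINT z|lborel. indicator {x<..<y} z * \<rho> z) = 0"
    then have "AE z in lborel. indicator {x<..<y} z * \<rho> z = 0"
      using integral_nonneg_eq_0_iff_AE[OF i] nn by simp
    then have "AE z in lborel. z \<notin> {x<..<y}"
      by eventually_elim (use d(2) in \<open>auto split: split_indicator_asm simp: less_le\<close>)
    then have "emeasure lborel {x<..<y} = 0"
      using AE_iff_measurable[of "{x<..<y}" lborel "\<lambda>z. z \<notin> {x<..<y}"]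
      by (auto simp: greaterThanLessThan_def greaterThan_def lessThan_def Int_def)
    then show False using \<open>x < y\<close> by simp
  qed
  moreover have "(LINT z|lborel. indicator {x<..<y} z * \<rho> z) \<ge> 0"
    by (rule integral_nonneg_AE) (use nn in simp)
  ultimately show "cum_dist \<rho> x < cum_dist \<rho> y" using C by linarith
qed

lemma cum_dist_range:
  assumes \<rho>: "\<rho> \<in> pos_densities"
  shows "range (cum_dist \<rho>) = {0<..<1}"
proof
  show "range (cum_dist \<rho>) \<subseteq> {0<..<1}"
  proof
    fix f assume "f \<in> range (cum_dist \<rho>)"
    then obtain x where x: "f = cum_dist \<rho> x" by auto
    \<comment> \<open>The limits give only weak bounds; taking them at \<open>x - 1\<close> and
      \<open>x + 1\<close> makes them strict at \<open>x\<close>.\<close>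
    have "0 \<le> cum_dist \<rho> (x - 1)"
      by (rule tendsto_upperbound[OF cum_dist_tendsto(1)[OF \<rho>]])
        (use strict_mono_less_eq[OF strict_mono_cum_dist[OF \<rho>]]
            in \<open>auto simp: eventually_at_bot_linorder\<close>)
    moreover have "cum_dist \<rho> (x + 1) \<le> 1"
      by (rule tendsto_lowerbound[OF cum_dist_tendsto(2)[OF \<rho>]])
        (use strict_mono_less_eq[OF strict_mono_cum_dist[OF \<rho>]]
            in \<open>auto simp: eventually_at_top_linorder\<close>)
    moreover have "cum_dist \<rho> (x - 1) < cum_dist \<rho> x" "cum_dist \<rho> x < cum_dist \<rho> (x + 1)"
      by (simp_all add: strict_mono_less[OF strict_mono_cum_dist[OF \<rho>]])
    ultimately show "f \<in> {0<..<1}" using x by simp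
  qed
  show "{0<..<1} \<subseteq> range (cum_dist \<rho>)"
  proof
    fix f :: real assume f: "f \<in> {0<..<1}"
    obtain a where a: "cum_dist \<rho> a < f"
      using order_tendstoD(2)[OF cum_dist_tendsto(1)[OF \<rho>], of f] f
      by (auto simp: eventually_at_bot_linorder)
    obtain b where b: "f < cum_dist \<rho> b"
      using order_tendstoD(1)[OF cum_dist_tendsto(2)[OF \<rho>], of f] f
      by (auto simp: eventually_at_top_linorder)
    have "a < b"
      using strict_mono_less[OF strict_mono_cum_dist[OF \<rho>]] a b by (meson less_trans)
    then have "\<exists>x\<ge>a. x \<le> b \<and> cum_dist \<rho> x = f"
      using a b isCont_cum_dist[OF \<rho>] by (intro IVT) auto
    then show "f \<in> range (cum_dist \<rho>)" by auto
  qed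
qed

lemma cum_dist_bounds:
  assumes "\<rho> \<in> pos_densities"
  shows "0 < cum_dist \<rho> x" "cum_dist \<rho> x < 1"
  using cum_dist_range[OF assms] by (auto simp: set_eq_iff image_iff)

lemma cum_dist_quantile:
  "\<rho> \<in> pos_densities \<Longrightarrow> 0 < f \<Longrightarrow> f < 1 \<Longrightarrow> cum_dist \<rho> (quantile \<rho> f) = f"
  using cum_dist_range by (intro f_inv_into_f) auto

lemma quantile_cum_dist: "\<rho> \<in> pos_densities \<Longrightarrow> quantile \<rho> (cum_dist \<rho> x) = x"
  by (simp add: inv_f_f strict_mono_cum_dist strict_mono_imp_inj_on)

lemma continuous_on_quantile:
  assumes \<rho>: "\<rho> \<in> pos_densities"
  shows "continuous_on {0<..<1} (quantile \<rho>)"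
proof -
  \<comment> \<open>The parametrised result is used with a single instant of time.\<close>
  have "continuous_on ({0} \<times> {0<..<1}) (\<lambda>(t::real, f). quantile \<rho> f)"
    by (rule continuous_on_inverse_function[where F="\<lambda>_. cum_dist \<rho>" and Y=UNIV])
      (use strict_mono_cum_dist[OF \<rho>] cum_dist_quantile[OF \<rho>] in auto)
  from continuous_on_slice(2)[OF this] show ?thesis by simp
qed

section \<open>The Lorenz curve and what it determines\<close>

lemma lorenz_endpoints:
  "lorenz \<rho> 0 = 0" "lorenz \<rho> 1 = first_moment \<rho>"
  by (simp_all add: lorenz_def inv_cum_dist_def first_moment_def interval_integral_UNIV_eq)

lemma lorenz_interior:
  "0 < f \<Longrightarrow> f < 1 \<Longrightarrow> lorenz \<rho> f = partial_moment \<rho> (quantile \<rho> f)"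
  by (simp add: lorenz_def inv_cum_dist_def)

text \<open>The difference quotient lies between the quantiles at the two end points, which merge by
  continuity of the quantile function. No continuity of \<open>\<rho>\<close> enters, so the result
  also covers the unstructured densities obtained from membership in
  \<open>lorenz_curves\<close>.\<close>

lemma lorenz_has_derivative:
  assumes \<rho>: "\<rho> \<in> pos_densities" and f: "0 < f" "f < 1"
  shows "(lorenz \<rho> has_real_derivative quantile \<rho> f) (at f)"
proof -
  let ?G = "quantile \<rho>"
  have f01: "f \<in> {0<..<1}" using f by simp
  have bnd: "\<bar>(lorenz \<rho> g - lorenz \<rho> f) / (g - f) - ?G f\<bar> \<le> \<bar>?G g - ?G f\<bar>"
    if g: "g \<in> {0<..<1}" "g \<noteq> f" for g
  proof -
    have mono: "?G a \<le> ?G b" if "a \<in> {0<..<1}" "b \<in> {0<..<1}" "a \<le> b" for a b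
      using that strict_mono_less_eq[OF strict_mono_cum_dist[OF \<rho>], of "?G a" "?G b"]
      by (simp add: cum_dist_quantile[OF \<rho>])
    show ?thesis
    proof (cases "f < g")
      case True
      have "?G f * (g - f) \<le> lorenz \<rho> g - lorenz \<rho> f" "lorenz \<rho> g - lorenz \<rho> f \<le> ?G g * (g - f)"
        using partial_moment_bounds[OF \<rho> mono[of f g]] f01 g True
        by (simp_all add: cum_dist_quantile[OF \<rho>] lorenz_interior)
      then have "?G f \<le> (lorenz \<rho> g - lorenz \<rho> f) / (g - f)" "(lorenz \<rho> g - lorenz \<rho> f) / (g - f)
          \<le> ?G g"
        using True by (simp_all add: pos_le_divide_eq pos_divide_le_eq)
      then show ?thesis by simp
    next
      case False
      then have "g < f" using g by simp
      have "?G g * (f - g) \<le> lorenz \<rho> f - lorenz \<rho> g" "lorenz \<rho> f - lorenz \<rho> g \<le> ?G f * (f - g)"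
        using partial_moment_bounds[OF \<rho> mono[of g f]] f01 g \<open>g < f\<close>
        by (simp_all add: cum_dist_quantile[OF \<rho>] lorenz_interior)
      then have "?G g \<le> (lorenz \<rho> f - lorenz \<rho> g) / (f - g)" "(lorenz \<rho> f - lorenz \<rho> g) / (f - g)
          \<le> ?G f"
        using \<open>g < f\<close> by (simp_all add: pos_le_divide_eq pos_divide_le_eq)
      moreover have "(lorenz \<rho> g - lorenz \<rho> f) / (g - f) = (lorenz \<rho> f - lorenz \<rho> g) / (f - g)"
        using minus_divide_divide[of "lorenz \<rho> f - lorenz \<rho> g" "f - g"] by simp
      ultimately show ?thesis by simp
    qed
  qed
  have "(?G \<longlongrightarrow> ?G f) (at f)"
    using continuous_on_quantile[OF \<rho>] f01
    by (simp add: continuous_on_eq_continuous_at isContD)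
  then have "((\<lambda>g. \<bar>?G g - ?G f\<bar>) \<longlongrightarrow> 0) (at f)"
    by (simp add: LIM_zero tendsto_rabs_zero)
  then have "((\<lambda>g. (lorenz \<rho> g - lorenz \<rho> f) / (g - f) - ?G f) \<longlongrightarrow> 0) (at f)"
  proof (rule Lim_null_comparison[rotated])
    have "\<forall>\<^sub>F g in at f. g \<in> {0<..<1}"
      by (rule eventually_at_in_open') (use f01 in auto)
    moreover have "\<forall>\<^sub>F g in at f. g \<noteq> f"
      by (simp add: eventually_at_filter)
    ultimately show "\<forall>\<^sub>F g in at f. norm ((lorenz \<rho> g - lorenz \<rho> f) / (g - f) - ?G f)
        \<le> \<bar>?G g - ?G f\<bar>"
      by eventually_elim (use bnd in auto)
  qed
  then show ?thesis
    by (simp add: has_field_derivative_iff LIM_zero_cancel)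
qed

lemma deriv_lorenz:
  "\<rho> \<in> pos_densities \<Longrightarrow> 0 < f \<Longrightarrow> f < 1 \<Longrightarrow> deriv (lorenz \<rho>) f = quantile \<rho> f"
  by (rule DERIV_imp_deriv[OF lorenz_has_derivative])

lemma distribution_cong_AE:
  assumes "\<rho> \<in> pos_densities" "\<sigma> \<in> pos_densities" "AE x in lborel. \<rho> x = \<sigma> x"
  shows "cum_dist \<rho> = cum_dist \<sigma>" "first_moment \<rho> = first_moment \<sigma>" "lorenz \<rho> = lorenz \<sigma>"
proof -
  have m: "\<rho> \<in> borel_measurable borel" "\<sigma> \<in> borel_measurable borel"
    using assms pos_densitiesD(1) by auto
  show C: "cum_dist \<rho> = cum_dist \<sigma>"
    unfolding cum_dist_def
    by (intro ext interval_lebesgue_integral_cong_AE) (use m assms(3)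
        in \<open>auto elim: eventually_mono\<close>)
  show "first_moment \<rho> = first_moment \<sigma>"
    unfolding first_moment_def
    by (intro integral_cong_AE) (use m assms(3) in \<open>auto elim: eventually_mono\<close>)
  show "lorenz \<rho> = lorenz \<sigma>"
    unfolding lorenz_def inv_cum_dist_def C
    by (intro restrict_ext interval_lebesgue_integral_cong_AE) (use m assms(3)
        in \<open>auto elim: eventually_mono\<close>)
qed

text \<open>Differentiating the Lorenz curve returns the quantile function, whose inverse is the
  cdf.\<close>

lemma cum_dist_eq_if_lorenz_eq:
  assumes \<rho>: "\<rho> \<in> pos_densities" and \<sigma>: "\<sigma> \<in> pos_densities" and eq: "lorenz \<rho> = lorenz \<sigma>"
  shows "cum_dist \<rho> = cum_dist \<sigma>"
proof
  fix x
  note b = cum_dist_bounds[OF \<rho>, of x]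
  have "quantile \<sigma> (cum_dist \<rho> x) = x"
    using deriv_lorenz[OF \<rho> b] deriv_lorenz[OF \<sigma> b] eq quantile_cum_dist[OF \<rho>] by simp
  then show "cum_dist \<rho> x = cum_dist \<sigma> x"
    using cum_dist_quantile[OF \<sigma> b] by simp
qed

lemma AE_eq_if_cum_dist_eq:
  assumes \<rho>: "\<rho> \<in> pos_densities" and \<sigma>: "\<sigma> \<in> pos_densities" and eq: "cum_dist \<rho> = cum_dist \<sigma>"
  shows "AE x in lborel. \<rho> x = \<sigma> x"
  by (rule AE_eq_of_interval_integrals)
    (use pos_densitiesD[OF \<rho>] pos_densitiesD[OF \<sigma>] eq
        in \<open>auto simp: cum_dist_def fun_eq_iff less_imp_le\<close>)

text \<open>Replaces an arbitrary representative of a distribution by a continuous one. Equality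
  almost everywhere carries the finite first moment over to \<open>\<sigma>\<close>.\<close>

lemma pos_densities_of_cum_dist_derivative:
  assumes \<rho>: "\<rho> \<in> pos_densities" and d: "\<And>x. (cum_dist \<rho> has_real_derivative \<sigma> x) (at x)"
    and cont: "continuous_on UNIV \<sigma>" and pos: "\<And>x. 0 < \<sigma> x"
  shows "\<sigma> \<in> pos_densities" "AE x in lborel. \<rho> x = \<sigma> x"
proof -
  note r = pos_densitiesD[OF \<rho>]
  have isc: "isCont \<sigma> x" for x using cont by (simp add: continuous_on_eq_continuous_at)
  have m[measurable]: "\<sigma> \<in> borel_measurable borel"
    using cont by (rule borel_measurable_continuous_onI)
  \<comment> \<open>For a nonnegative derivative the fundamental theorem delivers integrability
    together with the value, here the difference of the limits 1 and 0 of the cdf.\<close>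
  have tot: "set_integrable lborel (einterval (-\<infinity>) \<infinity>) \<sigma>" "(LBINT x=-\<infinity>..\<infinity>. \<sigma> x) = 1 - 0"
    by (rule interval_integral_FTC_nonneg[where F="cum_dist \<rho>"];
      use d isc pos cum_dist_tendsto[OF \<rho>] in \<open>auto simp: ereal_tendsto_simps less_imp_le\<close>)+
  have i: "integrable lborel \<sigma>" using tot(1) by (simp add: set_integrable_def)
  have part: "(LBINT y=-\<infinity>..ereal x. \<sigma> y) = cum_dist \<rho> x - 0" for x
    by (rule interval_integral_FTC_nonneg(2)[where F="cum_dist \<rho>"];
      use d isc pos cum_dist_tendsto[OF \<rho>] isCont_cum_dist[OF \<rho>, of x] in
        \<open>auto simp: ereal_tendsto_simps less_imp_le isCont_def intro: tendsto_within_subset\<close>)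
  show ae: "AE x in lborel. \<rho> x = \<sigma> x"
    by (rule AE_eq_of_interval_integrals) (use r i pos part
        in \<open>auto simp: cum_dist_def less_imp_le\<close>)
  have "integrable lborel (\<lambda>x. x * \<sigma> x)"
    by (rule integrable_cong_AE_imp[OF r(5)]) (use ae in \<open>auto elim: eventually_mono\<close>)
  then show "\<sigma> \<in> pos_densities"
    using m pos i tot(2) by (simp add: pos_densities_def interval_integral_UNIV_eq)
qed

section \<open>The integrated cdf\<close>

lemma cum_dist_has_derivative:
  assumes "\<rho> \<in> pos_densities" "continuous_on UNIV \<rho>"
  shows "(cum_dist \<rho> has_real_derivative \<rho> x) (at x)"
  using interval_integral_Iio_has_derivative[OF pos_densitiesD(3)[OF assms(1)] assms(2)]
  by (simp add: cum_dist_def[abs_def])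

text \<open>
  Equals \<open>\<integral> cum_dist \<rho>\<close> over \<open>(-\<infinity>, x]\<close>, in a form that needs only the first moment to exist.
\<close>

definition cdf_integral :: "(real \<Rightarrow> real) \<Rightarrow> real \<Rightarrow> real" where
  "cdf_integral \<rho> x = x * cum_dist \<rho> x - partial_moment \<rho> x"

text \<open>The product rule and the partial moment each contribute \<open>x * \<rho> x\<close>,
  with opposite signs, which leaves the cdf.\<close>

lemma cdf_integral_has_derivative:
  assumes "\<rho> \<in> pos_densities" "continuous_on UNIV \<rho>"
  shows "(cdf_integral \<rho> has_real_derivative cum_dist \<rho> x) (at x)"
proof -
  have "(partial_moment \<rho> has_real_derivative x * \<rho> x) (at x)"
    by (rule interval_integral_Iio_has_derivative[OF pos_densitiesD(5)[OF assms(1)]])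
      (use assms(2) in \<open>auto intro!: continuous_intros\<close>)
  with cum_dist_has_derivative[OF assms, of x] show ?thesis
    unfolding cdf_integral_def[abs_def] by (auto intro!: derivative_eq_intros)
qed

text \<open>For \<open>x \<le> 0\<close> the product \<open>x * cum_dist \<rho> x\<close> is
  squeezed between the partial moment and 0, and the partial moment vanishes at minus infinity
  because the first moment is finite.\<close>

lemma cdf_integral_tendsto_at_bot:
  assumes \<rho>: "\<rho> \<in> pos_densities"
  shows "(cdf_integral \<rho> \<longlongrightarrow> 0) at_bot"
proof -
  note d = pos_densitiesD[OF \<rho>]
  have lim: "(partial_moment \<rho> \<longlongrightarrow> 0) at_bot"
    by (rule interval_integral_Iio_tendsto(1)[OF d(5)])
  have le: "partial_moment \<rho> x \<le> x * cum_dist \<rho> x" for x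
  proof -
    have i: "integrable lborel (\<lambda>z. indicator {..<x} z * (z * \<rho> z))"
        "integrable lborel (\<lambda>z. x * (indicator {..<x} z * \<rho> z))"
      using integrable_mult_indicator[OF _ d(5), of "{..<x}"] integrable_mult_indicator[OF _ d(3),
          of "{..<x}"] by auto
    have "(LINT z|lborel. indicator {..<x} z * (z * \<rho> z))
        \<le> (LINT z|lborel. x * (indicator {..<x} z * \<rho> z))"
      by (rule integral_mono[OF i]) (use d(2) in \<open>auto split: split_indicator\<close>)
    then show ?thesis by (simp add: cum_dist_def interval_integral_Iio_eq)
  qed
  have "((\<lambda>x. x * cum_dist \<rho> x) \<longlongrightarrow> 0) at_bot"
  proof (rule tendsto_sandwich[OF _ _ lim tendsto_const])
    show "\<forall>\<^sub>F x in at_bot. x * cum_dist \<rho> x \<le> 0"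
      using eventually_le_at_bot[of 0]
      by eventually_elim (use cum_dist_bounds[OF \<rho>] in \<open>auto simp: mult_le_0_iff less_imp_le\<close>)
  qed (use le in simp)
  from tendsto_diff[OF this lim] show ?thesis
    by (simp add: cdf_integral_def[abs_def])
qed

lemma lorenz_eq_legendre:
  "\<rho> \<in> pos_densities \<Longrightarrow> 0 < f \<Longrightarrow> f < 1 \<Longrightarrow>
    lorenz \<rho> f = quantile \<rho> f * f - cdf_integral \<rho> (quantile \<rho> f)"
  by (simp add: lorenz_interior cdf_integral_def cum_dist_quantile)

section \<open>Substitution of the cdf\<close>

text \<open>The probability integral transform: the cdf applied to its own random variable is
  uniform on the unit interval. Both laws are compared on \<open>{a<..}\<close>, where the quantile
  at \<open>a\<close> converts the event for \<open>0 < a < 1\<close>.\<close>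

lemma distr_cum_dist:
  assumes \<rho>: "\<rho> \<in> pos_densities"
  shows "distr (density lborel \<rho>) borel (cum_dist \<rho>) = density lborel (indicator {0<..<1})"
proof (rule measure_eqI_lessThan)
  note d = pos_densitiesD[OF \<rho>]
  have [measurable]: "cum_dist \<rho> \<in> borel_measurable borel"
    using isCont_cum_dist[OF \<rho>] by (intro borel_measurable_continuous_onI) (simp add:
        continuous_on_eq_continuous_at)
  have [measurable]: "\<rho> \<in> borel_measurable borel" by (rule d)
  have R: "emeasure (density lborel (indicator {0<..<1})) {a<..}
      = emeasure lborel ({0<..<1} \<inter> {a<..})" for a :: real
    by (subst emeasure_density) (auto simp: indicator_inter_arith[symmetric] simp del:
        nn_integral_indicator intro!: nn_integral_indicator)
  have L: "emeasure (distr (density lborel \<rho>) borel (cum_dist \<rho>)) {a<..}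
      = emeasure (density lborel \<rho>) {x. a < cum_dist \<rho> x}" for a
    by (subst emeasure_distr) (auto simp: vimage_def)
  have tot: "emeasure (density lborel \<rho>) UNIV = 1"
    using nn_integral_eq_integral[OF d(3)] d(2,4) by (subst emeasure_density)
        (auto simp: less_imp_le)
  have tail: "emeasure (density lborel \<rho>) {x<..} = ennreal (1 - cum_dist \<rho> x)" for x
    using d by (subst emeasure_density_Ioi) (auto simp: cum_dist_def less_imp_le)
  show "emeasure (distr (density lborel \<rho>) borel (cum_dist \<rho>)) {a<..} =
      emeasure (density lborel (indicator {0<..<1})) {a<..}" for a
  proof -
    consider "a \<le> 0" | "1 \<le> a" | "0 < a" "a < 1" by linarith
    then show ?thesis
    proof cases
      case 1
      then have "{x. a < cum_dist \<rho> x} = UNIV" "{0<..<1} \<inter> {a<..} = {0<..<1}"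
        using cum_dist_bounds(1)[OF \<rho>] by (auto intro: le_less_trans)
      then show ?thesis by (simp add: L R tot)
    next
      case 2
      then have "{x. a < cum_dist \<rho> x} = {}" "{0<..<1} \<inter> {a<..} = {}"
        using order_trans[OF less_imp_le[OF cum_dist_bounds(2)[OF \<rho>]] 2] by (auto simp: not_less)
      then show ?thesis unfolding L R by simp
    next
      case 3
      have "a < cum_dist \<rho> x \<longleftrightarrow> quantile \<rho> a < x" for x
        using strict_mono_less[OF strict_mono_cum_dist[OF \<rho>], of "quantile \<rho> a" x]
          cum_dist_quantile[OF \<rho> 3] by simp
      then have "{x. a < cum_dist \<rho> x} = {quantile \<rho> a<..}"
        unfolding greaterThan_def by (simp only:)
      moreover have "{0<..<1} \<inter> {a<..} = {a<..<1}"
        by (rule set_eqI) (use 3(1) in \<open>simp add: conj_commute; linarith\<close>)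
      ultimately show ?thesis
        using 3 unfolding L R by (simp add: tail cum_dist_quantile[OF \<rho> 3])
    qed
  qed
  show "emeasure (distr (density lborel \<rho>) borel (cum_dist \<rho>)) {a<..} < \<infinity>" for a
  proof -
    have "emeasure (density lborel \<rho>) {x. a < cum_dist \<rho> x} \<le> emeasure (density lborel \<rho>) UNIV"
      by (rule emeasure_mono) auto
    then show ?thesis by (simp add: L tot order.strict_trans1[OF _ ennreal_one_less_top])
  qed
qed auto

text \<open>The change of variables is a push-forward of measures, so the cdf need not be
  differentiated. Continuity of \<open>k\<close> provides measurability.\<close>

lemma nn_integral_cum_dist_substitution:
  assumes \<rho>: "\<rho> \<in> pos_densities" and k: "continuous_on UNIV k" "\<And>x. 0 \<le> k x"
  shows "(\<integral>\<^sup>+f\<in>{0<..<1}. ennreal (k (quantile \<rho> f)) \<partial>lborel) = (\<integral>\<^sup>+x. ennreal (k x * \<rho> x) \<partial>lborel)"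
proof -
  note d = pos_densitiesD[OF \<rho>]
  have [measurable]: "\<rho> \<in> borel_measurable borel" "k \<in> borel_measurable borel"
    using d(1) k(1) borel_measurable_continuous_onI by auto
  have [measurable]: "cum_dist \<rho> \<in> borel_measurable borel"
    using isCont_cum_dist[OF \<rho>] by (intro borel_measurable_continuous_onI) (simp add:
        continuous_on_eq_continuous_at)
  \<comment> \<open>Outside the open unit interval \<open>quantile\<close> is an arbitrary value of
    \<open>inv\<close>; the indicator removes it and makes \<open>h\<close> Borel on the whole
    line.\<close>
  define h where "h = (\<lambda>f. ennreal (k (quantile \<rho> f)) * indicator {0<..<1} f)"
  have "(\<lambda>f. indicator {0<..<1} f *\<^sub>R k (quantile \<rho> f)) \<in> borel_measurable borel"
    by (rule borel_measurable_continuous_on_indicator)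
      (use continuous_on_compose2[OF k(1) continuous_on_quantile[OF \<rho>]] in auto)
  then have "(\<lambda>f. ennreal (indicator {0<..<1} f *\<^sub>R k (quantile \<rho> f))) \<in> borel_measurable borel"
    by measurable
  also have "(\<lambda>f. ennreal (indicator {0<..<1} f *\<^sub>R k (quantile \<rho> f))) = h"
    by (auto simp: h_def fun_eq_iff split: split_indicator)
  finally have [measurable]: "h \<in> borel_measurable borel" .
  have "(\<integral>\<^sup>+f\<in>{0<..<1}. ennreal (k (quantile \<rho> f)) \<partial>lborel)
      = (\<integral>\<^sup>+f. indicator {0<..<1} f * h f \<partial>lborel)"
    by (intro nn_integral_cong) (auto simp: h_def split: split_indicator)
  also have "\<dots> = (\<integral>\<^sup>+f. h f \<partial>distr (density lborel \<rho>) borel (cum_dist \<rho>))"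
    unfolding distr_cum_dist[OF \<rho>] by (subst nn_integral_density) auto
  also have "\<dots> = (\<integral>\<^sup>+x. ennreal (\<rho> x) * h (cum_dist \<rho> x) \<partial>lborel)"
    by (simp add: nn_integral_distr nn_integral_density)
  also have "\<dots> = (\<integral>\<^sup>+x. ennreal (k x * \<rho> x) \<partial>lborel)"
    using k(2) d(2) cum_dist_bounds[OF \<rho>]
    by (intro nn_integral_cong) (simp add: h_def quantile_cum_dist[OF \<rho>] ennreal_mult'
        mult.commute less_imp_le)
  finally show ?thesis .
qed

section \<open>Curves of densities and of Lorenz curves\<close>

lemma at_within_unit_interval_neq_bot: "t \<in> {0..1} \<Longrightarrow> at t within {0..1::real} \<noteq> bot"
  by (simp add: trivial_limit_within islimpt_Icc)

lemma at_within_open_neq_bot: "open X \<Longrightarrow> x \<in> X \<Longrightarrow> at x within X \<noteq> bot" for x :: real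
  using at_within_open[of x X] by simp

lemma smooth2_partialsE:
  assumes "smooth2_on {0..1} X u" "open X"
  obtains ut ux where "smooth2_on {0..1} X ut" "smooth2_on {0..1} X ux"
      "partials_on {0..1} X u ut ux"
  using assms
  by (rule_tac smooth2_on_partials[OF assms(1) at_within_unit_interval_neq_bot
      at_within_open_neq_bot]) auto

lemma partials_on_open_DERIV:
  "partials_on T X u ut ux \<Longrightarrow> open X \<Longrightarrow> t \<in> T \<Longrightarrow> x \<in> X \<Longrightarrow> (u t has_real_derivative ux t x) (at x)"
  using partials_onD(2) at_within_open by metis

text \<open>Each derivative is matched with a jointly smooth \<open>v\<close>, which keeps the next
  differentiation in space available in the induction.\<close>

lemma iterated_deriv_slice:
  assumes "smooth2_on {0..1} UNIV u"
  shows "\<exists>v. smooth2_on {0..1} UNIV v \<and> (\<forall>t\<in>{0..1}. (deriv ^^ n) (u t) = v t)"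
proof (induction n)
  case 0
  then show ?case using assms by auto
next
  case (Suc n)
  then obtain v where v: "smooth2_on {0..1} UNIV v" "\<forall>t\<in>{0..1}. (deriv ^^ n) (u t) = v t" by blast
  obtain vt vx where p: "smooth2_on {0..1} UNIV vx" "partials_on {0..1} UNIV v vt vx"
    using v(1) open_UNIV by (rule smooth2_partialsE)
  have "deriv (v t) = vx t" if "t \<in> {0..1}" for t
    using partials_on_open_DERIV[OF p(2) open_UNIV that] by (auto intro: DERIV_imp_deriv)
  with v(2) p(1) show ?case by auto
qed

text \<open>Links joint smoothness of a curve to the notion under which continuity of
  \<open>d\<close> in \<open>x\<close> is assumed.\<close>

lemma smooth_line_slice:
  assumes "smooth2_on {0..1} UNIV u" "t \<in> {0..1}"
  shows "smooth_line (u t)"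
  unfolding smooth_line_def
proof
  fix n
  obtain v where v: "smooth2_on {0..1} UNIV v" "\<forall>t\<in>{0..1}. (deriv ^^ n) (u t) = v t"
    using iterated_deriv_slice[OF assms(1)] by blast
  obtain vt vx where p: "partials_on {0..1} UNIV v vt vx"
    using v(1) open_UNIV by (rule smooth2_partialsE)
  show "(deriv ^^ n) (u t) differentiable_on UNIV"
    using partials_on_open_DERIV[OF p open_UNIV assms(2)] v(2) assms(2)
    by (auto simp: differentiable_on_def real_differentiable_def)
qed

section \<open>Second derivative of the Lorenz curve and the energy\<close>

lemma deriv_lorenz_has_derivative:
  assumes \<rho>: "\<rho> \<in> pos_densities" "continuous_on UNIV \<rho>" and f: "0 < f" "f < 1"
  shows "(deriv (lorenz \<rho>) has_real_derivative inverse (\<rho> (quantile \<rho> f))) (at f)"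
proof (rule has_field_derivative_transform_within_open[where S="{0<..<1}"])
  show "(quantile \<rho> has_real_derivative inverse (\<rho> (quantile \<rho> f))) (at f)"
  proof (rule DERIV_inverse_function[where a=0 and b=1])
    show "(cum_dist \<rho> has_real_derivative \<rho> (quantile \<rho> f)) (at (quantile \<rho> f))"
      by (rule cum_dist_has_derivative[OF \<rho>])
    show "\<rho> (quantile \<rho> f) \<noteq> 0" using pos_densitiesD(2)[OF \<rho>(1), of "quantile \<rho> f"] by simp
    show "isCont (quantile \<rho>) f"
      using continuous_on_quantile[OF \<rho>(1)] f by (simp add: continuous_on_eq_continuous_at)
  qed (use f cum_dist_quantile[OF \<rho>(1)] in auto)
qed (use f deriv_lorenz[OF \<rho>(1)] in auto)

text \<open>For a continuous density the recovery holds at every point. This matters because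
  \<open>d\<close> takes a function as argument and could distinguish representatives that agree
  almost everywhere.\<close>

lemma lorenz_density_lorenz:
  assumes \<rho>: "\<rho> \<in> pos_densities" "continuous_on UNIV \<rho>"
  shows "lorenz_density (lorenz \<rho>) = \<rho>"
proof
  fix x
  note b = cum_dist_bounds[OF \<rho>(1)]
  have "inj_on (deriv (lorenz \<rho>)) {0<..<1}"
  proof (rule inj_onI)
    fix f g :: real assume fg: "f \<in> {0<..<1}" "g \<in> {0<..<1}" "deriv (lorenz \<rho>) f
        = deriv (lorenz \<rho>) g"
    then have "quantile \<rho> f = quantile \<rho> g"
      by (simp add: deriv_lorenz[OF \<rho>(1)])
    with fg(1,2) show "f = g"
      by (metis cum_dist_quantile[OF \<rho>(1)] greaterThanLessThan_iff)
  qed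
  then have "inv_into {0<..<1} (deriv (lorenz \<rho>)) x = cum_dist \<rho> x"
  proof (rule inv_into_f_eq)
    show "cum_dist \<rho> x \<in> {0<..<1}" using b[of x] by simp
    show "deriv (lorenz \<rho>) (cum_dist \<rho> x) = x"
      by (simp add: deriv_lorenz[OF \<rho>(1) b] quantile_cum_dist[OF \<rho>(1)])
  qed
  then show "lorenz_density (lorenz \<rho>) x = \<rho> x"
    using DERIV_imp_deriv[OF deriv_lorenz_has_derivative[OF \<rho> b]]
    by (simp add: lorenz_density_def quantile_cum_dist[OF \<rho>(1)] divide_inverse)
qed

lemma lorenz_norm_sq_eq:
  assumes \<rho>: "\<rho> \<in> pos_densities" "continuous_on UNIV \<rho>"
    and d: "continuous_on UNIV (\<lambda>x. d x \<rho>)" "\<And>x. 0 < d x \<rho>" and J: "continuous_on UNIV J"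
    and \<eta>: "\<And>f. 0 < f \<Longrightarrow> f < 1 \<Longrightarrow> \<eta> f = - J (quantile \<rho> f)"
  shows "lorenz_norm_sq d (lorenz \<rho>) \<eta> = (\<integral>\<^sup>+x. ennreal ((J x)\<^sup>2 / (d x \<rho> * \<rho> x)) \<partial>lborel)"
proof -
  define k where "k = (\<lambda>x. 1 / d x \<rho> * (inverse (\<rho> x))\<^sup>2 * (J x)\<^sup>2)"
  have pos: "0 < \<rho> x" for x by (rule pos_densitiesD(2)[OF \<rho>(1)])
  have "lorenz_norm_sq d (lorenz \<rho>) \<eta> = (\<integral>\<^sup>+f\<in>{0<..<1}. ennreal (k (quantile \<rho> f)) \<partial>lborel)"
    unfolding lorenz_norm_sq_def
    by (intro nn_integral_cong)
      (auto simp: k_def lorenz_coeff_def lorenz_density_lorenz[OF \<rho>] deriv_lorenz[OF \<rho>(1)] \<eta>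
        DERIV_imp_deriv[OF deriv_lorenz_has_derivative[OF \<rho>]] split: split_indicator)
  also have "\<dots> = (\<integral>\<^sup>+x. ennreal (k x * \<rho> x) \<partial>lborel)"
  proof (rule nn_integral_cum_dist_substitution[OF \<rho>(1)])
    show "continuous_on UNIV k"
      unfolding k_def using \<rho>(2) d J pos
      by (intro continuous_intros) (auto simp: order.strict_implies_not_eq[symmetric])
    show "0 \<le> k x" for x using d(2)[of x] by (simp add: k_def)
  qed
  also have "\<dots> = (\<integral>\<^sup>+x. ennreal ((J x)\<^sup>2 / (d x \<rho> * \<rho> x)) \<partial>lborel)"
  proof (intro nn_integral_cong arg_cong[where f=ennreal])
    fix x show "k x * \<rho> x = (J x)\<^sup>2 / (d x \<rho> * \<rho> x)"
      using pos[of x] d(2)[of x] by (simp add: k_def field_simps power2_eq_square)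
  qed
  finally show ?thesis .
qed

text \<open>With flux \<open>J = D * p\<close>, where \<open>p\<close> is the second derivative of
  \<open>\<psi> t\<close>, the quotient of \<open>J^2\<close> by \<open>D = d * \<rho>\<close> is
  \<open>D * p^2\<close>. The sign of the velocity disappears in the square.\<close>

lemma lorenz_norm_sq_eq_CD_energy:
  assumes "\<And>x \<rho>. \<rho> \<in> pos_densities \<Longrightarrow> 0 < d x \<rho>"
    and "\<And>\<rho>. \<rho> \<in> pos_densities \<Longrightarrow> smooth_line \<rho> \<Longrightarrow> continuous_on UNIV (\<lambda>x. d x \<rho>)"
    and "\<And>x \<rho>. \<rho> \<in> pos_densities \<Longrightarrow> D x \<rho> = d x \<rho> * \<rho> x"
    and \<rho>: "\<rho> t \<in> pos_densities" and smooth: "smooth2_on {0..1} UNIV \<rho>"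
    and J: "smooth2_on {0..1} UNIV (CD_flux D \<rho> \<psi>)" and t: "t \<in> {0..1}"
    and \<eta>: "\<And>f. 0 < f \<Longrightarrow> f < 1 \<Longrightarrow> \<eta> f = - CD_flux D \<rho> \<psi> t (quantile (\<rho> t) f)"
  shows "lorenz_norm_sq d (lorenz (\<rho> t)) \<eta> =
    (\<integral>\<^sup>+x. ennreal (D x (\<rho> t) * (deriv (deriv (\<psi> t)) x)\<^sup>2) \<partial>lborel)"
proof -
  have "lorenz_norm_sq d (lorenz (\<rho> t)) \<eta> =
      (\<integral>\<^sup>+x. ennreal ((CD_flux D \<rho> \<psi> t x)\<^sup>2 / (d x (\<rho> t) * \<rho> t x)) \<partial>lborel)"
  proof (rule lorenz_norm_sq_eq[where J="CD_flux D \<rho> \<psi> t", OF \<rho> _ _ _ _ \<eta>])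
    show "continuous_on UNIV (\<lambda>x. d x (\<rho> t))"
      by (rule assms(2)[OF \<rho> smooth_line_slice[OF smooth t]])
  qed (use assms(1) \<rho> continuous_on_slice(2)[OF smooth2_on_continuous t] smooth J in auto)
  also have "\<dots> = (\<integral>\<^sup>+x. ennreal (D x (\<rho> t) * (deriv (deriv (\<psi> t)) x)\<^sup>2) \<partial>lborel)"
  proof (intro nn_integral_cong arg_cong[where f=ennreal])
    fix x
    have "d x (\<rho> t) * \<rho> t x \<noteq> 0"
      using assms(1)[OF \<rho>, of x] pos_densitiesD(2)[OF \<rho>, of x] by simp
    then show "(CD_flux D \<rho> \<psi> t x)\<^sup>2 / (d x (\<rho> t) * \<rho> t x) = D x (\<rho> t) * (deriv (deriv (\<psi> t)) x)\<^sup>2"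
      by (simp add: CD_flux_def assms(3)[OF \<rho>] power2_eq_square)
  qed
  finally show ?thesis .
qed

lemma time_deriv_eq:
  assumes "((\<lambda>s. L s f) has_real_derivative v) (at t within {0..1})" "t \<in> {0..1}"
  shows "time_deriv L t f = v"
  unfolding time_deriv_def
  by (rule vector_derivative_within[OF at_within_unit_interval_neq_bot[OF assms(2)]])
    (use assms(1) in \<open>simp add: has_real_derivative_iff_has_vector_derivative\<close>)

section \<open>Evolution of the cdf and decay at the boundary\<close>

text \<open>The slope is the difference of the values at \<open>x\<close> and \<open>x - 1\<close>,
  both of which tend to 0.\<close>

lemma affine_tendsto_0_at_bot:
  fixes c c' :: real
  assumes "((\<lambda>x. c * x + c') \<longlongrightarrow> 0) at_bot"
  shows "c = 0" "c' = 0"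
proof -
  have "filterlim (\<lambda>x::real. x - 1) at_bot at_bot"
    by (rule filterlim_at_bot_mono[OF filterlim_ident]) auto
  from tendsto_diff[OF assms filterlim_compose[OF assms this]]
  have "((\<lambda>x::real. c) \<longlongrightarrow> 0) at_bot" by (simp add: algebra_simps)
  then show c: "c = 0" by (simp add: tendsto_const_iff)
  with assms show "c' = 0" by (simp add: tendsto_const_iff)
qed

lemma DERIV_zero_UNIV_const:
  fixes f :: "real \<Rightarrow> real"
  assumes "\<And>x. (f has_real_derivative 0) (at x)"
  obtains c where "\<And>x. f x = c"
  using DERIV_isconst_all[of f] assms by blast

text \<open>Since \<open>\<delta>\<close> does not depend on \<open>t\<close>, smallness near the
  boundary is controlled by the second coordinate alone, which gives joint continuity there.\<close>

lemma continuous_on_extend_by_zero: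
  fixes w :: "real \<Rightarrow> real \<Rightarrow> real"
  assumes cont: "continuous_on (T \<times> {0<..<1}) (\<lambda>(t, f). w t f)"
    and bdry: "\<And>e. 0 < e \<Longrightarrow> \<exists>\<delta>>0. \<forall>t\<in>T. \<forall>f\<in>{0<..<1}. f < \<delta> \<or> 1 - \<delta> < f \<longrightarrow> \<bar>w t f\<bar> < e"
  shows "continuous_on (T \<times> {0..1}) (\<lambda>(t, f). if f \<in> {0<..<1} then w t f else 0)"
    (is "continuous_on _ ?w")
  unfolding continuous_on_eq_continuous_within
proof
  fix p assume p: "p \<in> T \<times> {0..1::real}"
  show "continuous (at p within T \<times> {0..1}) ?w"
  proof (cases "snd p \<in> {0<..<1}")
    case True
    have "continuous_on (T \<times> {0<..<1}) ?w"
      by (rule continuous_on_cong[THEN iffD1, OF refl _ cont]) auto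
    then have "continuous (at p within T \<times> {0<..<1}) ?w"
      using p True by (auto simp: continuous_on_eq_continuous_within)
    moreover have "at p within T \<times> {0..1} = at p within T \<times> {0<..<1}"
      by (rule at_within_nhd[where S="UNIV \<times> {0<..<1}"]) (use p True in \<open>auto intro: open_Times\<close>)
    ultimately show ?thesis by simp
  next
    case False
    have "(?w \<longlongrightarrow> 0) (at p within T \<times> {0..1})"
    proof (rule tendstoI)
      fix e :: real assume "0 < e"
      from bdry[OF this] obtain \<delta> where \<delta>: "\<delta> > 0"
        "\<And>t f. t \<in> T \<Longrightarrow> f \<in> {0<..<1} \<Longrightarrow> f < \<delta> \<or> 1 - \<delta> < f \<Longrightarrow> \<bar>w t f\<bar> < e" by blast
      have "((\<lambda>q. snd q) \<longlongrightarrow> snd p) (at p within T \<times> {0..1})"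
        by (intro tendsto_intros)
      from tendstoD[OF this \<delta>(1)] have "\<forall>\<^sub>F q in at p within T \<times> {0..1}. dist (snd q) (snd p) < \<delta>" .
      moreover have "\<forall>\<^sub>F q in at p within T \<times> {0..1}. q \<in> T \<times> {0..1}"
        by (simp add: eventually_at_filter)
      ultimately show "\<forall>\<^sub>F q in at p within T \<times> {0..1}. dist (?w q) 0 < e"
      proof eventually_elim
        case (elim q)
        have "snd p = 0 \<or> snd p = 1" using p False by auto
        then have "snd q < \<delta> \<or> 1 - \<delta> < snd q" using elim(1) by (auto simp: dist_real_def)
        then show ?case using elim(2) \<delta>(2)[of "fst q" "snd q"] \<open>0 < e\<close> by
            (auto simp: case_prod_unfold)
      qed
    qed
    then show ?thesis using False by (auto simp: continuous_within case_prod_unfold)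
  qed
qed

lemma uniform_limit_at_bot_0D:
  fixes J :: "real \<Rightarrow> real \<Rightarrow> real"
  assumes "uniform_limit T (\<lambda>x t. J t x) (\<lambda>t. 0) at_bot" "0 < e"
  obtains b where "\<And>x t. x \<le> b \<Longrightarrow> t \<in> T \<Longrightarrow> \<bar>J t x\<bar> < e"
  using uniform_limitD[OF assms] by (auto simp: eventually_at_bot_linorder)

lemma uniform_limit_at_top_0D:
  fixes J :: "real \<Rightarrow> real \<Rightarrow> real"
  assumes "uniform_limit T (\<lambda>x t. J t x) (\<lambda>t. 0) at_top" "0 < e"
  obtains b where "\<And>x t. b \<le> x \<Longrightarrow> t \<in> T \<Longrightarrow> \<bar>J t x\<bar> < e"
  using uniform_limitD[OF assms] by (auto simp: eventually_at_top_linorder)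

lemma continuous_pos_lower_bound:
  fixes h :: "real \<Rightarrow> real"
  assumes "continuous_on {0..1} h" "\<And>t. t \<in> {0..1} \<Longrightarrow> 0 < h t"
  obtains \<delta> where "\<delta> > 0" "\<And>t. t \<in> {0..1} \<Longrightarrow> \<delta> \<le> h t"
proof -
  obtain t0 where "t0 \<in> {0..1}" "\<forall>t\<in>{0..1}. h t0 \<le> h t"
    using continuous_attains_inf[OF compact_Icc _ assms(1)] by auto
  then show ?thesis using assms(2) that[of "h t0"] by auto
qed

text \<open>
  The two sides of \<open>K(t, x) = K(0, x) + \<integral> J\<close> (time integral over \<open>{0..t}\<close>) have the same second
  \<open>x\<close>-derivative, so they differ by an affine function of \<open>x\<close>, which is zero because both sides
  vanish at \<open>-\<infinity>\<close>.
\<close>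

lemma cdf_integral_evolution:
  assumes \<rho>: "\<And>t. t \<in> {0..1} \<Longrightarrow> \<rho> t \<in> pos_densities" and \<rho>_cont:
      "continuous_on ({0..1} \<times> UNIV) (\<lambda>(t, x). \<rho> t x)"
    and J: "smooth2_on {0..1} UNIV J" "partials_on {0..1} UNIV J Jt Jx"
    and Jx: "smooth2_on {0..1} UNIV Jx" "partials_on {0..1} UNIV Jx Jxt Jxx"
    and Jxx: "smooth2_on {0..1} UNIV Jxx"
    and lim: "uniform_limit {0..1} (\<lambda>x t. J t x) (\<lambda>t. 0) at_bot"
    and pde: "\<And>t x. t \<in> {0..1} \<Longrightarrow> ((\<lambda>s. \<rho> s x) has_real_derivative Jxx t x) (at t within {0..1})"
  shows "partials_on {0..1} UNIV (\<lambda>t. cdf_integral (\<rho> t)) J (\<lambda>t. cum_dist (\<rho> t))"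
    and "partials_on {0..1} UNIV (\<lambda>t. cum_dist (\<rho> t)) Jx \<rho>"
proof -
  have cont: "continuous_on UNIV (\<rho> t)" if "t \<in> {0..1}" for t
    by (rule continuous_on_slice(2)[OF \<rho>_cont that])
  note K' = cdf_integral_has_derivative[OF \<rho> cont]
  note C' = cum_dist_has_derivative[OF \<rho> cont]
  note cJ = smooth2_on_continuous[OF J(1)]
  note cJx = smooth2_on_continuous[OF Jx(1)]
  note cJxx = smooth2_on_continuous[OF Jxx]
  have K_C: "cdf_integral (\<rho> t) x = cdf_integral (\<rho> 0) x + integral {0..t} (\<lambda>s. J s x) \<and>
      cum_dist (\<rho> t) x = cum_dist (\<rho> 0) x + integral {0..t} (\<lambda>s. Jx s x)" if t: "t \<in> {0..1}" for t x
  proof -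
    define A where "A x = cdf_integral (\<rho> 0) x + integral {0..t} (\<lambda>s. J s x)" for x
    define B where "B x = cum_dist (\<rho> 0) x + integral {0..t} (\<lambda>s. Jx s x)" for x
    have A: "(A has_real_derivative B x) (at x)" for x
      using K'[of 0 x] has_derivative_time_integral[OF cJ cJx partials_onD(2)[OF J(2)], of x t] t
      unfolding A_def[abs_def] B_def by (auto intro!: derivative_eq_intros)
    have B: "(B has_real_derivative \<rho> t x) (at x)" for x
    proof -
      have "(B has_real_derivative \<rho> 0 x + integral {0..t} (\<lambda>s. Jxx s x)) (at x)"
        using C'[of 0 x] has_derivative_time_integral[OF cJx cJxx partials_onD(2)[OF Jx(2)], of x
            t] t
        unfolding B_def[abs_def] by (auto intro!: derivative_eq_intros)
      then show ?thesis
        using time_integral_of_derivative[OF pde t, of x] by simp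
    qed
    have "((\<lambda>x. cum_dist (\<rho> t) x - B x) has_real_derivative 0) (at x)" for x
      using DERIV_diff[OF C'[OF t t] B] by simp
    then obtain c where c: "\<And>x. cum_dist (\<rho> t) x - B x = c"
      by (rule DERIV_zero_UNIV_const) blast
    have "((\<lambda>x. cdf_integral (\<rho> t) x - A x - c * x) has_real_derivative 0) (at x)" for x
      using K'[OF t t, of x] A[of x] c[of x] by (auto intro!: derivative_eq_intros)
    then obtain c' where c': "\<And>x. cdf_integral (\<rho> t) x - A x - c * x = c'"
      by (rule DERIV_zero_UNIV_const) blast
    \<comment> \<open>Decay uniform in time lets the limit pass through the time integral over an
      interval of length at most 1.\<close>
    have J0: "((\<lambda>x. integral {0..t} (\<lambda>s. J s x)) \<longlongrightarrow> 0) at_bot"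
    proof (rule tendstoI)
      fix e :: real assume "0 < e"
      then have "0 < e / 2" by simp
      with lim obtain b where b: "\<And>x t. x \<le> b \<Longrightarrow> t \<in> {0..1} \<Longrightarrow> \<bar>J t x\<bar> < e / 2"
        by (rule uniform_limit_at_bot_0D) blast
      show "\<forall>\<^sub>F x in at_bot. dist (integral {0..t} (\<lambda>s. J s x)) 0 < e"
        using eventually_le_at_bot[of b]
      proof eventually_elim
        case (elim x)
        have "norm (integral {0..t} (\<lambda>s. J s x)) \<le> e / 2 * (t - 0)"
        proof (rule integral_bound)
          show "continuous_on {0..t} (\<lambda>s. J s x)"
            by (rule continuous_on_subset[OF continuous_on_slice(1)[OF cJ]]) (use t in auto)
          show "norm (J s x) \<le> e / 2" if "s \<in> {0..t}" for s
            using b[OF elim, of s] that t by simp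
        qed (use t in simp)
        also have "\<dots> \<le> e / 2" using t \<open>0 < e\<close> by (simp add: mult_left_le)
        finally show ?case using \<open>0 < e\<close> by simp
      qed
    qed
    have "((\<lambda>x. cdf_integral (\<rho> t) x - A x) \<longlongrightarrow> 0) at_bot"
      using tendsto_diff[OF cdf_integral_tendsto_at_bot[OF \<rho>[OF t]]
          tendsto_add[OF cdf_integral_tendsto_at_bot[OF \<rho>[of 0]] J0]]
      by (simp add: A_def)
    moreover have "cdf_integral (\<rho> t) x - A x = c * x + c'" for x
      using c'[of x] by simp
    ultimately have "((\<lambda>x. c * x + c') \<longlongrightarrow> 0) at_bot" by simp
    from affine_tendsto_0_at_bot[OF this] have "cdf_integral (\<rho> t) x = A x" "cum_dist (\<rho> t) x = B x"
      using c[of x] c'[of x] by auto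
    then show ?thesis unfolding A_def B_def by blast
  qed
  show "partials_on {0..1} UNIV (\<lambda>t. cdf_integral (\<rho> t)) J (\<lambda>t. cum_dist (\<rho> t))"
    unfolding partials_on_def
  proof (intro ballI conjI)
    fix t x :: real assume t: "t \<in> {0..1}"
    have "((\<lambda>t. cdf_integral (\<rho> 0) x + integral {0..t} (\<lambda>s. J s x)) has_real_derivative J t x)
        (at t within {0..1})"
      using integral_has_real_derivative[OF continuous_on_slice(1)[OF cJ] t, of x]
      by (auto intro!: derivative_eq_intros)
    then show "((\<lambda>s. cdf_integral (\<rho> s) x) has_real_derivative J t x) (at t within {0..1})"
      by (rule has_real_derivative_cong_within[OF _ t conjunct1[OF K_C]])
    show "(cdf_integral (\<rho> t) has_real_derivative cum_dist (\<rho> t) x) (at x within UNIV)"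
      using K'[OF t t] by simp
  qed
  show "partials_on {0..1} UNIV (\<lambda>t. cum_dist (\<rho> t)) Jx \<rho>"
    unfolding partials_on_def
  proof (intro ballI conjI)
    fix t x :: real assume t: "t \<in> {0..1}"
    have "((\<lambda>t. cum_dist (\<rho> 0) x + integral {0..t} (\<lambda>s. Jx s x)) has_real_derivative Jx t x)
        (at t within {0..1})"
      using integral_has_real_derivative[OF continuous_on_slice(1)[OF cJx] t, of x]
      by (auto intro!: derivative_eq_intros)
    then show "((\<lambda>s. cum_dist (\<rho> s) x) has_real_derivative Jx t x) (at t within {0..1})"
      by (rule has_real_derivative_cong_within[OF _ t conjunct2[OF K_C]])
    show "(cum_dist (\<rho> t) has_real_derivative \<rho> t x) (at x within UNIV)"
      using C'[OF t t] by simp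
  qed
qed

text \<open>Uniform decay gives points \<open>a\<close> and \<open>b\<close> beyond which the flux
  is small at all times. By compactness in time, the cdf at \<open>a\<close> is bounded away from 0
  and the cdf at \<open>b\<close> away from 1; levels closer to 0 or 1 than these margins have
  quantiles beyond \<open>a\<close> or \<open>b\<close>.\<close>

lemma boundary_decay_of_flux:
  fixes J :: "real \<Rightarrow> real \<Rightarrow> real"
  assumes \<rho>: "\<And>t. t \<in> {0..1} \<Longrightarrow> \<rho> t \<in> pos_densities"
    and C: "continuous_on ({0..1} \<times> UNIV) (\<lambda>(t, x). cum_dist (\<rho> t) x)"
    and bot: "uniform_limit {0..1} (\<lambda>x t. J t x) (\<lambda>t. 0) at_bot"
    and top: "uniform_limit {0..1} (\<lambda>x t. J t x) (\<lambda>t. 0) at_top" and e: "(0::real) < e"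
  shows "\<exists>\<delta>>0. \<forall>t\<in>{0..1}. \<forall>f\<in>{0<..<1}. f < \<delta> \<or> 1 - \<delta> < f \<longrightarrow> \<bar>- J t (quantile (\<rho> t) f)\<bar> < e"
proof -
  obtain a where a: "\<And>x t. x \<le> a \<Longrightarrow> t \<in> {0..1} \<Longrightarrow> \<bar>J t x\<bar> < e"
    using bot e by (rule uniform_limit_at_bot_0D) blast
  obtain b where b: "\<And>x t. b \<le> x \<Longrightarrow> t \<in> {0..1} \<Longrightarrow> \<bar>J t x\<bar> < e"
    using top e by (rule uniform_limit_at_top_0D) blast
  have cont: "continuous_on {0..1} (\<lambda>t. cum_dist (\<rho> t) x)" for x
    by (rule continuous_on_slice(1)[OF C]) simp
  obtain \<delta>1 where \<delta>1: "\<delta>1 > 0" "\<And>t. t \<in> {0..1} \<Longrightarrow> \<delta>1 \<le> cum_dist (\<rho> t) a"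
    using cum_dist_bounds(1)[OF \<rho>] by (rule_tac continuous_pos_lower_bound[OF cont[of a]]) auto
  have cont': "continuous_on {0..1} (\<lambda>t. 1 - cum_dist (\<rho> t) b)"
    by (intro continuous_intros cont)
  obtain \<delta>2 where \<delta>2: "\<delta>2 > 0" "\<And>t. t \<in> {0..1} \<Longrightarrow> \<delta>2 \<le> 1 - cum_dist (\<rho> t) b"
    using cum_dist_bounds(2)[OF \<rho>] by (rule_tac continuous_pos_lower_bound[OF cont']) auto
  have "\<bar>- J t (quantile (\<rho> t) f)\<bar> < e"
    if t: "t \<in> {0..1}" and f: "f \<in> {0<..<1}" and *: "f < min \<delta>1 \<delta>2 \<or> 1 - min \<delta>1 \<delta>2 < f" for t f
  proof -
    have less: "f < cum_dist (\<rho> t) x \<longleftrightarrow> quantile (\<rho> t) f < x" "cum_dist (\<rho> t) x < f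
        \<longleftrightarrow> x < quantile (\<rho> t) f" for x
      using strict_mono_less[OF strict_mono_cum_dist[OF \<rho>[OF t]], of "quantile (\<rho> t) f" x]
        strict_mono_less[OF strict_mono_cum_dist[OF \<rho>[OF t]], of x "quantile (\<rho> t) f"]
        cum_dist_quantile[OF \<rho>[OF t], of f] f by auto
    have "f < cum_dist (\<rho> t) a \<or> cum_dist (\<rho> t) b < f"
      using * \<delta>1(2)[OF t] \<delta>2(2)[OF t] by linarith
    then have "quantile (\<rho> t) f < a \<or> b < quantile (\<rho> t) f"
      unfolding less .
    then show ?thesis using a[OF _ t] b[OF _ t] by (auto simp: less_imp_le)
  qed
  then show ?thesis
    using \<delta>1(1) \<delta>2(1) by (intro exI[of _ "min \<delta>1 \<delta>2"]) auto
qed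

section \<open>From curves of densities to Lorenz paths\<close>

text \<open>Regularity rests on explicit partials: the cdf has partials \<open>Jx\<close> and
  \<open>\<rho>\<close>, the quantile is its inverse, and the Lorenz curve has partials
  \<open>w\<close> and the quantile.\<close>

lemma lorenz_path_of_CD_curve:
  assumes \<rho>0: "\<rho>0 \<in> pos_densities" and \<rho>1: "\<rho>1 \<in> pos_densities" and curve: "CD_curve D \<rho>0 \<rho>1 \<rho> \<psi>"
  shows "lorenz_path (lorenz \<rho>0) (lorenz \<rho>1) (\<lambda>t. lorenz (\<rho> t))"
    and "\<And>t f. t \<in> {0..1} \<Longrightarrow> 0 < f \<Longrightarrow> f < 1 \<Longrightarrow>
      time_deriv (\<lambda>t. lorenz (\<rho> t)) t f = - CD_flux D \<rho> \<psi> t (quantile (\<rho> t) f)"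
proof -
  define J where "J = CD_flux D \<rho> \<psi>"
  have \<rho>: "\<rho> t \<in> pos_densities" if "t \<in> {0..1}" for t
    using curve that by (simp add: CD_curve_def)
  have smooth: "smooth2_on {0..1} UNIV \<rho>" "smooth2_on {0..1} UNIV J"
    and lim: "uniform_limit {0..1} (\<lambda>x t. J t x) (\<lambda>t. 0) at_bot"
        "uniform_limit {0..1} (\<lambda>x t. J t x) (\<lambda>t. 0) at_top"
    and pde: "\<And>t x. t \<in> {0..1} \<Longrightarrow> ((\<lambda>s. \<rho> s x) has_real_derivative deriv (deriv (J t)) x)
        (at t within {0..1})"
    and ends: "AE x in lborel. \<rho> 0 x = \<rho>0 x" "AE x in lborel. \<rho> 1 x = \<rho>1 x"
    and mean: "\<And>t. t \<in> {0..1} \<Longrightarrow> ((\<lambda>s. first_moment (\<rho> s)) has_real_derivative 0)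
        (at t within {0..1})"
    using curve by (auto simp: CD_curve_def J_def)
  obtain Jt Jx where J: "smooth2_on {0..1} UNIV Jx" "partials_on {0..1} UNIV J Jt Jx"
    using smooth(2) open_UNIV by (rule smooth2_partialsE)
  obtain Jxt Jxx where Jx: "smooth2_on {0..1} UNIV Jxx" "partials_on {0..1} UNIV Jx Jxt Jxx"
    using J(1) open_UNIV by (rule smooth2_partialsE)
  have \<rho>_cont: "continuous_on UNIV (\<rho> t)" if "t \<in> {0..1}" for t
    by (rule continuous_on_slice(2)[OF smooth2_on_continuous[OF smooth(1)] that])
  have dJ: "deriv (J t) = Jx t" if "t \<in> {0..1}" for t
    using partials_on_open_DERIV[OF J(2) open_UNIV that] by (auto intro: DERIV_imp_deriv)
  have ddJ: "deriv (Jx t) = Jxx t" if "t \<in> {0..1}" for t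
    using partials_on_open_DERIV[OF Jx(2) open_UNIV that] by (auto intro: DERIV_imp_deriv)
  have pde': "((\<lambda>s. \<rho> s x) has_real_derivative Jxx t x) (at t within {0..1})" if "t \<in> {0..1}"
      for t x
    using pde[OF that] dJ[OF that] ddJ[OF that] by simp
  note evolution = cdf_integral_evolution[OF _ smooth2_on_continuous[OF smooth(1)] smooth(2) J(2)
      J(1) Jx(2,1) lim(1)]
  have KC: "partials_on {0..1} UNIV (\<lambda>t. cdf_integral (\<rho> t)) J (\<lambda>t. cum_dist (\<rho> t))"
    "partials_on {0..1} UNIV (\<lambda>t. cum_dist (\<rho> t)) Jx \<rho>"
    using evolution \<rho> pde' by blast+
  have C: "smooth2_on {0..1} UNIV (\<lambda>t. cum_dist (\<rho> t))"
    by (rule smooth2_onI[OF J(1) smooth(1) KC(2) convex_UNIV])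
  have range: "cum_dist (\<rho> t) ` UNIV = {0<..<1}" if "t \<in> {0..1}" for t
    by (rule cum_dist_range[OF \<rho>[OF that]])
  have Cq: "cum_dist (\<rho> t) (quantile (\<rho> t) f) = f" if "t \<in> {0..1}" "f \<in> {0<..<1}" for t f
    using cum_dist_quantile[OF \<rho>] that by simp
  have G: "smooth2_on {0..1} {0<..<1} (\<lambda>t. quantile (\<rho> t))"
    by (rule smooth2_on_inverse_function[OF KC(2) J(1) smooth(1) pos_densitiesD(2)[OF \<rho>] _ _ range
        _ Cq]) auto
  define L where "L = (\<lambda>t. lorenz (\<rho> t))"
  define w where "w t f = - J t (quantile (\<rho> t) f)" for t f
  have Lt: "((\<lambda>s. L s f) has_real_derivative w t f) (at t within {0..1})"
    if t: "t \<in> {0..1}" and f: "f \<in> {0<..<1}" for t f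
  proof -
    obtain Gt Gf where Gp: "partials_on {0..1} {0<..<1} (\<lambda>t. quantile (\<rho> t)) Gt Gf"
      using G open_greaterThanLessThan by (rule smooth2_partialsE)
    \<comment> \<open>The envelope argument: the motion of the quantile contributes
      \<open>f * Gt t f\<close> here, because the cdf at the quantile is \<open>f\<close>. It
      cancels against the derivative of \<open>quantile (\<rho> s) f * f\<close>.\<close>
    have "((\<lambda>s. cdf_integral (\<rho> s) (quantile (\<rho> s) f)) has_real_derivative
        J t (quantile (\<rho> t) f) + cum_dist (\<rho> t) (quantile (\<rho> t) f) * Gt t f) (at t within {0..1})"
      by (rule chain_rule_curve[OF KC(1) smooth2_on_continuous[OF C] convex_UNIV t
          partials_onD(1)[OF Gp t f]]) simp
    with partials_onD(1)[OF Gp t f]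
    have "((\<lambda>s. quantile (\<rho> s) f * f - cdf_integral (\<rho> s) (quantile (\<rho> s) f))
        has_real_derivative w t f) (at t within {0..1})"
      by (auto intro!: derivative_eq_intros simp: w_def Cq[OF t f])
    then show ?thesis
      by (rule has_real_derivative_cong_within[OF _ t]) (use lorenz_eq_legendre[OF \<rho>] f
          in \<open>auto simp: L_def\<close>)
  qed
  have Lp: "partials_on {0..1} {0<..<1} L w (\<lambda>t. quantile (\<rho> t))"
    unfolding partials_on_def
    using Lt lorenz_has_derivative[OF \<rho>] by (auto simp: L_def intro: has_field_derivative_at_within)
  have w: "smooth2_on {0..1} {0<..<1} w"
    unfolding w_def by (rule smooth2_on_minus[OF smooth2_on_compose[OF smooth(2) G]]) auto
  have L: "smooth2_on {0..1} {0<..<1} L"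
    by (rule smooth2_onI[OF w G Lp]) simp
  have td: "time_deriv L t f = w t f" if "t \<in> {0..1}" "f \<in> {0<..<1}" for t f
    by (rule time_deriv_eq[where L=L, OF Lt[OF that] that(1)])
  then show "\<And>t f. t \<in> {0..1} \<Longrightarrow> 0 < f \<Longrightarrow> f < 1 \<Longrightarrow>
      time_deriv (\<lambda>t. lorenz (\<rho> t)) t f = - CD_flux D \<rho> \<psi> t (quantile (\<rho> t) f)"
    by (simp add: L_def w_def J_def)
  have L1: "((\<lambda>s. L s 1) has_real_derivative 0) (at t within {0..1})" if "t \<in> {0..1}" for t
    using mean[OF that] by (simp add: L_def lorenz_endpoints)
  have td_bdry: "time_deriv L t f = 0" if t: "t \<in> {0..1}" and "f = 0 \<or> f = 1" for t f
    using that(2)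
  proof
    assume "f = 0"
    then show ?thesis by (intro time_deriv_eq[where L=L, OF _ t]) (simp add: L_def lorenz_endpoints)
  qed (use time_deriv_eq[where L=L, OF L1 t] t in simp)
  \<comment> \<open>The flux formula for the velocity holds only for interior \<open>f\<close>; at
    the boundary the velocity is 0, and decay of the flux joins the two pieces continuously.\<close>
  have "continuous_on ({0..1} \<times> {0..1}) (\<lambda>(t, f). if f \<in> {0<..<1} then w t f else 0)"
    by (rule continuous_on_extend_by_zero[OF smooth2_on_continuous[OF w]], unfold w_def,
        rule boundary_decay_of_flux[OF \<rho> smooth2_on_continuous[OF C] lim])
  then have td_cont: "continuous_on ({0..1} \<times> {0..1}) (\<lambda>(t, f). time_deriv L t f)"
  proof (rule continuous_on_cong[THEN iffD1, OF refl, rotated])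
    fix p :: "real \<times> real" assume p: "p \<in> {0..1} \<times> {0..1}"
    then have "snd p \<in> {0<..<1} \<or> snd p = 0 \<or> snd p = 1" by auto
    then show "(case p of (t, f) \<Rightarrow> if f \<in> {0<..<1} then w t f else 0)
        = (case p of (t, f) \<Rightarrow> time_deriv L t f)"
      using td[of "fst p" "snd p"] td_bdry[of "fst p" "snd p"] p by (cases p) auto
  qed
  have "0 < deriv (deriv (L t)) f" if "t \<in> {0..1}" "f \<in> {0<..<1}" for t f
    using DERIV_imp_deriv[OF deriv_lorenz_has_derivative[OF \<rho> \<rho>_cont], of t f] that
      pos_densitiesD(2)[OF \<rho>, of t "quantile (\<rho> t) f"] by (simp add: L_def)
  moreover have "L 0 = lorenz \<rho>0" "L 1 = lorenz \<rho>1"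
    using distribution_cong_AE(3)[OF \<rho> \<rho>0 ends(1)] distribution_cong_AE(3)[OF \<rho> \<rho>1 ends(2)] by
        (auto simp: L_def)
  ultimately have "lorenz_path (lorenz \<rho>0) (lorenz \<rho>1) L"
    using L td_cont L1 \<rho> by (auto simp: lorenz_path_def lorenz_curves_def L_def)
  then show "lorenz_path (lorenz \<rho>0) (lorenz \<rho>1) (\<lambda>t. lorenz (\<rho> t))"
    by (simp add: L_def)
qed

section \<open>From Lorenz paths to curves of densities\<close>

lemma antiderivative_UNIV:
  fixes w :: "real \<Rightarrow> real"
  assumes "continuous_on UNIV w"
  obtains p where "\<And>x. (p has_real_derivative w x) (at x)"
  using einterval_antiderivative[of "-\<infinity>" \<infinity> w] assms
  by (auto simp: continuous_on_eq_continuous_at has_real_derivative_iff_has_vector_derivative)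

text \<open>Produces the potential \<open>\<psi> t\<close> at a fixed time from its prescribed
  second derivative.\<close>

lemma second_antiderivative_UNIV:
  fixes w :: "real \<Rightarrow> real"
  assumes "continuous_on UNIV w"
  obtains p where "p differentiable_on UNIV" "deriv p differentiable_on UNIV" "deriv (deriv p) = w"
proof -
  obtain q where q: "\<And>x. (q has_real_derivative w x) (at x)"
    using antiderivative_UNIV[OF assms] by blast
  have "continuous_on UNIV q"
    using q by (auto intro: DERIV_continuous_on)
  then obtain p where p: "\<And>x. (p has_real_derivative q x) (at x)"
    using antiderivative_UNIV by blast
  have [simp]: "deriv p = q" "deriv q = w"
    using p q by (auto intro: DERIV_imp_deriv)
  show thesis
    using p q by (intro that[of p]) (auto simp: differentiable_on_def real_differentiable_def)
qed

text \<open>Uniform continuity on the compact square makes \<open>w\<close> small for levels within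
  \<open>\<delta>\<close> of the boundary at all times. The quantiles at levels
  \<open>\<delta>\<close> and \<open>1 - \<delta>\<close> are bounded over the compact time
  interval, so every point far enough out has such a level.\<close>

lemma uniform_limit_of_boundary_decay:
  fixes w :: "real \<Rightarrow> real \<Rightarrow> real"
  assumes \<rho>: "\<And>t. t \<in> {0..1} \<Longrightarrow> \<rho> t \<in> pos_densities"
    and G: "continuous_on ({0..1} \<times> {0<..<1}) (\<lambda>(t, f). quantile (\<rho> t) f)"
    and w: "continuous_on ({0..1} \<times> {0..1}) (\<lambda>(t, f). w t f)"
    and w0: "\<And>t. t \<in> {0..1} \<Longrightarrow> w t 0 = 0" "\<And>t. t \<in> {0..1} \<Longrightarrow> w t 1 = 0"
  shows "uniform_limit {0..1} (\<lambda>x t. - w t (cum_dist (\<rho> t) x)) (\<lambda>t. 0) at_bot"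
    and "uniform_limit {0..1} (\<lambda>x t. - w t (cum_dist (\<rho> t) x)) (\<lambda>t. 0) at_top"
proof -
  have small: "\<exists>\<delta>>0. \<delta> < 1 \<and> (\<forall>t\<in>{0..1}. \<forall>f\<in>{0..1}. f < \<delta> \<or> 1 - \<delta> < f \<longrightarrow> \<bar>w t f\<bar> < e)" if e:
      "0 < e" for e
  proof -
    have "uniformly_continuous_on ({0..1} \<times> {0..1}) (\<lambda>(t, f). w t f)"
      by (rule compact_uniformly_continuous[OF w]) (intro compact_Times compact_Icc)
    from uniformly_continuous_onE[OF this e] obtain \<delta> where \<delta>: "\<delta> > 0"
      "\<And>p q. p \<in> {0..1} \<times> {0..1} \<Longrightarrow> q \<in> {0..1} \<times> {0..1} \<Longrightarrow> dist q p < \<delta> \<Longrightarrow>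
        dist (case q of (t, f) \<Rightarrow> w t f) (case p of (t, f) \<Rightarrow> w t f) < e" by metis
    \<comment> \<open>The cap 1/2 keeps \<open>\<delta>\<close> and \<open>1 - \<delta>\<close>
      strictly inside the unit interval, where the quantile is meaningful.\<close>
    have "\<bar>w t f\<bar> < e" if t: "t \<in> {0..1}" and f: "f \<in> {0..1}" and *:
        "f < min \<delta> (1/2) \<or> 1 - min \<delta> (1/2) < f" for t f
    proof (cases "f < min \<delta> (1/2)")
      case True
      then show ?thesis
        using \<delta>(2)[of "(t, 0)" "(t, f)"] t f w0(1)[OF t] by (simp add: dist_Pair_Pair dist_real_def)
    next
      case False
      then have "1 - f < \<delta>" using * by linarith
      then show ?thesis
        using \<delta>(2)[of "(t, 1)" "(t, f)"] t f w0(2)[OF t] by (simp add: dist_Pair_Pair dist_real_def)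
    qed
    then show ?thesis
      using \<delta>(1) by (intro exI[of _ "min \<delta> (1/2)"]) auto
  qed
  have less: "cum_dist (\<rho> t) x < f \<longleftrightarrow> x < quantile (\<rho> t) f" "f < cum_dist (\<rho> t) x
      \<longleftrightarrow> quantile (\<rho> t) f < x"
    if "t \<in> {0..1}" "0 < f" "f < 1" for t x f
    using strict_mono_less[OF strict_mono_cum_dist[OF \<rho>[OF that(1)]], of x "quantile (\<rho> t) f"]
      strict_mono_less[OF strict_mono_cum_dist[OF \<rho>[OF that(1)]], of "quantile (\<rho> t) f" x]
      cum_dist_quantile[OF \<rho>[OF that(1)] that(2,3)] by auto
  have C01: "cum_dist (\<rho> t) x \<in> {0..1}" if "t \<in> {0..1}" for t x
    using cum_dist_bounds[OF \<rho>[OF that], of x] by simp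
  show "uniform_limit {0..1} (\<lambda>x t. - w t (cum_dist (\<rho> t) x)) (\<lambda>t. 0) at_bot"
  proof (rule uniform_limitI)
    fix e :: real assume "0 < e"
    from small[OF this] obtain \<delta> where \<delta>: "0 < \<delta>" "\<delta> < 1"
      "\<And>t f. t \<in> {0..1} \<Longrightarrow> f \<in> {0..1} \<Longrightarrow> f < \<delta> \<Longrightarrow> \<bar>w t f\<bar> < e" by blast
    obtain b where b: "\<forall>t\<in>{0..1}. b \<le> quantile (\<rho> t) \<delta>"
      using continuous_attains_inf[OF compact_Icc _ continuous_on_slice(1)[OF G, of \<delta>]] \<delta>(1,2) by
          auto
    show "\<forall>\<^sub>F x in at_bot. \<forall>t\<in>{0..1}. dist (- w t (cum_dist (\<rho> t) x)) 0 < e"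
      using eventually_gt_at_bot[of b]
    proof eventually_elim
      case (elim x)
      show ?case
      proof
        fix t :: real assume t: "t \<in> {0..1}"
        have "x < quantile (\<rho> t) \<delta>" using elim b t by fastforce
        then have "cum_dist (\<rho> t) x < \<delta>" using less(1)[OF t \<delta>(1,2)] by simp
        then show "dist (- w t (cum_dist (\<rho> t) x)) 0 < e" using \<delta>(3)[OF t C01[OF t]] by simp
      qed
    qed
  qed
  show "uniform_limit {0..1} (\<lambda>x t. - w t (cum_dist (\<rho> t) x)) (\<lambda>t. 0) at_top"
  proof (rule uniform_limitI)
    fix e :: real assume "0 < e"
    from small[OF this] obtain \<delta> where \<delta>: "0 < \<delta>" "\<delta> < 1"
      "\<And>t f. t \<in> {0..1} \<Longrightarrow> f \<in> {0..1} \<Longrightarrow> 1 - \<delta> < f \<Longrightarrow> \<bar>w t f\<bar> < e" by blast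
    obtain b where b: "\<forall>t\<in>{0..1}. quantile (\<rho> t) (1 - \<delta>) \<le> b"
      using continuous_attains_sup[OF compact_Icc _ continuous_on_slice(1)[OF G, of
          "1 - \<delta>"]] \<delta>(1,2) by auto
    show "\<forall>\<^sub>F x in at_top. \<forall>t\<in>{0..1}. dist (- w t (cum_dist (\<rho> t) x)) 0 < e"
      using eventually_gt_at_top[of b]
    proof eventually_elim
      case (elim x)
      show ?case
      proof
        fix t :: real assume t: "t \<in> {0..1}"
        have "quantile (\<rho> t) (1 - \<delta>) < x" using elim b t by fastforce
        then have "1 - \<delta> < cum_dist (\<rho> t) x" using less(2)[OF t, of "1 - \<delta>"] \<delta>(1,2) by simp
        then show "dist (- w t (cum_dist (\<rho> t) x)) 0 < e" using \<delta>(3)[OF t C01[OF t]] by simp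
      qed
    qed
  qed
qed

text \<open>The densities \<open>r t\<close> come from a choice at each time and may vary wildly in
  \<open>t\<close>, but their cdf inverts the slope \<open>Lf\<close> and is thus jointly smooth by
  the implicit function result. Its space derivative \<open>1 / Lff\<close> at the cdf gives the
  smooth representatives.\<close>

lemma CD_curve_of_lorenz_path:
  assumes d_pos: "\<And>x \<rho>. \<rho> \<in> pos_densities \<Longrightarrow> 0 < d x \<rho>"
    and d_regular: "\<And>\<rho>. \<rho> \<in> pos_densities \<Longrightarrow> smooth_line \<rho> \<Longrightarrow> continuous_on UNIV (\<lambda>x. d x \<rho>)"
    and D_eq: "\<And>x \<rho>. \<rho> \<in> pos_densities \<Longrightarrow> D x \<rho> = d x \<rho> * \<rho> x"
    and \<rho>0: "\<rho>0 \<in> pos_densities" and \<rho>1: "\<rho>1 \<in> pos_densities"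
    and path: "lorenz_path (lorenz \<rho>0) (lorenz \<rho>1) L"
  obtains \<rho> \<psi> where "CD_curve D \<rho>0 \<rho>1 \<rho> \<psi>" "\<And>t. t \<in> {0..1} \<Longrightarrow> L t = lorenz (\<rho> t)"
proof -
  have curves: "\<forall>t\<in>{0..1}. \<exists>r. r \<in> pos_densities \<and> L t = lorenz r"
    and L: "smooth2_on {0..1} {0<..<1} L"
    and convex: "\<And>t f. t \<in> {0..1} \<Longrightarrow> f \<in> {0<..<1} \<Longrightarrow> 0 < deriv (deriv (L t)) f"
    and td_cont: "continuous_on ({0..1} \<times> {0..1}) (\<lambda>(t, f). time_deriv L t f)"
    and ends: "L 0 = lorenz \<rho>0" "L 1 = lorenz \<rho>1"
    and L1: "\<And>t. t \<in> {0..1} \<Longrightarrow> ((\<lambda>s. L s 1) has_real_derivative 0) (at t within {0..1})"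
    using path by (auto simp: lorenz_path_def lorenz_curves_def)
  obtain r where r: "\<And>t. t \<in> {0..1} \<Longrightarrow> r t \<in> pos_densities" "\<And>t. t \<in> {0..1} \<Longrightarrow> L t = lorenz (r t)"
    using curves by metis
  have I: "open {0<..<1::real}" "convex {0<..<1::real}" by auto
  obtain Lt Lf where Lp: "smooth2_on {0..1} {0<..<1} Lt" "smooth2_on {0..1} {0<..<1} Lf"
      "partials_on {0..1} {0<..<1} L Lt Lf"
    using L I(1) by (rule smooth2_partialsE)
  obtain Lft Lff where Lfp: "smooth2_on {0..1} {0<..<1} Lft" "smooth2_on {0..1} {0<..<1} Lff"
      "partials_on {0..1} {0<..<1} Lf Lft Lff"
    using Lp(2) I(1) by (rule smooth2_partialsE)
  obtain Ltt Ltf where Ltp: "smooth2_on {0..1} {0<..<1} Ltf"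
      "partials_on {0..1} {0<..<1} Lt Ltt Ltf"
    using Lp(1) I(1) by (rule smooth2_partialsE)
  \<comment> \<open>\<open>Lft\<close> arises as the time derivative of the slope and
    \<open>Ltf\<close> as the space derivative of the velocity; their equality will match the flux
    with the motion of the cdf.\<close>
  have Lft_eq: "Lft t f = Ltf t f" if "t \<in> {0..1}" "f \<in> {0<..<1}" for t f
    using real_derivative_unique_within[OF partials_onD(1)[OF Lfp(3) that]
        mixed_partials[OF Lp(3) Ltp(2) smooth2_on_continuous[OF Lp(1)] smooth2_on_continuous[OF
            Ltp(1)] I(2,1) that]]
      at_within_unit_interval_neq_bot[OF that(1)] by simp
  have Lf: "Lf t f = deriv (L t) f" "Lf t f = quantile (r t) f" if "t \<in> {0..1}" "f \<in> {0<..<1}"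
      for t f
    using DERIV_imp_deriv[OF partials_on_open_DERIV[OF Lp(3) I(1) that]] deriv_lorenz[OF r(1)[OF
        that(1)], of f] r(2) that
    by auto
  have Lff: "Lff t f = deriv (deriv (L t)) f" if "t \<in> {0..1}" "f \<in> {0<..<1}" for t f
    by (rule DERIV_imp_deriv[symmetric],
        rule has_field_derivative_transform_within_open[OF partials_on_open_DERIV[OF Lfp(3) I(1)
            that] I(1) that(2)])
      (use Lf(1) that in auto)
  have Lff_pos: "0 < Lff t f" if "t \<in> {0..1}" "f \<in> {0<..<1}" for t f
    using convex[OF that] Lff[OF that] by simp
  define C where "C t = cum_dist (r t)" for t
  have C01: "C t x \<in> {0<..<1}" if "t \<in> {0..1}" for t x
    using cum_dist_bounds[OF r(1)[OF that]] by (simp add: C_def)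
  have LfC: "Lf t (C t x) = x" if "t \<in> {0..1}" for t x
    using Lf(2)[OF that C01[OF that]] quantile_cum_dist[OF r(1)[OF that]] by (simp add: C_def)
  have Lf_range: "Lf t ` {0<..<1} = UNIV" if "t \<in> {0..1}" for t
    using LfC[OF that] C01[OF that] by (metis UNIV_eq_I image_eqI)
  note inv = partials_on_inverse_function[OF Lfp(3) smooth2_on_continuous[OF Lfp(2)] Lff_pos
      I(2,1) Lf_range C01 LfC]
  have C: "smooth2_on {0..1} UNIV C"
    by (rule smooth2_on_inverse_function[OF Lfp(3,1,2) Lff_pos I(2,1) Lf_range C01 LfC])
  define \<rho> where "\<rho> t x = inverse (Lff t (C t x))" for t x
  define J where "J t x = - Lt t (C t x)" for t x
  define Ct where "Ct t x = - (Lft t (C t x) * inverse (Lff t (C t x)))" for t x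
  have Cp: "partials_on {0..1} UNIV C Ct \<rho>"
    using inv(2) by (simp add: \<rho>_def[abs_def] Ct_def[abs_def])
  have \<rho>_smooth: "smooth2_on {0..1} UNIV \<rho>"
    unfolding \<rho>_def
    by (rule smooth2_on_inverse[OF smooth2_on_compose[OF Lfp(2) C I(2) C01]]) (use Lff_pos C01
        in \<open>auto simp: order.strict_implies_not_eq[symmetric]\<close>)
  have J: "smooth2_on {0..1} UNIV J"
    unfolding J_def by (rule smooth2_on_minus[OF smooth2_on_compose[OF Lp(1) C I(2) C01]])
  have \<rho>_pos: "0 < \<rho> t x" if "t \<in> {0..1}" for t x
    using Lff_pos[OF that C01[OF that]] by (simp add: \<rho>_def)
  have \<rho>_cont: "continuous_on UNIV (\<rho> t)" if "t \<in> {0..1}" for t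
    by (rule continuous_on_slice(2)[OF smooth2_on_continuous[OF \<rho>_smooth] that])
  have \<rho>: "\<rho> t \<in> pos_densities" "AE x in lborel. r t x = \<rho> t x" if "t \<in> {0..1}" for t
    using pos_densities_of_cum_dist_derivative[OF r(1)[OF that], of
        "\<rho> t"] partials_on_open_DERIV[OF Cp open_UNIV that]
      \<rho>_cont[OF that] \<rho>_pos[OF that] by (auto simp: C_def)
  have L_eq: "L t = lorenz (\<rho> t)" and C_eq: "C t = cum_dist (\<rho> t)" if "t \<in> {0..1}" for t
    using distribution_cong_AE[OF r(1) \<rho>] r(2) that by (auto simp: C_def)
  \<comment> \<open>Differentiating \<open>J\<close> gives \<open>- Ltf * \<rho>\<close> at the
    level \<open>C t x\<close>, where \<open>\<rho>\<close> is the inverse of \<open>Lff\<close>; by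
    symmetry of mixed partials this is the time derivative of the cdf.\<close>
  have Jx: "(J t has_real_derivative Ct t x) (at x)" if t: "t \<in> {0..1}" for t x
  proof -
    have "((\<lambda>x. Lt t (C t x)) has_real_derivative Ltf t (C t x) * \<rho> t x) (at x)"
      by (rule DERIV_chain2[OF partials_on_open_DERIV[OF Ltp(2) I(1) t C01[OF t]]
          partials_on_open_DERIV[OF Cp open_UNIV t UNIV_I]])
    from DERIV_minus[OF this] show ?thesis
      by (simp add: J_def[abs_def] Ct_def \<rho>_def Lft_eq[OF t C01[OF t]])
  qed
  obtain Jt Jx' where Jp: "smooth2_on {0..1} UNIV Jx'" "partials_on {0..1} UNIV J Jt Jx'"
    using J open_UNIV by (rule smooth2_partialsE)
  \<comment> \<open>Identifying \<open>Ct\<close> with the space derivative of the smooth flux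
    supplies its smoothness.\<close>
  have "Jx' t x = Ct t x" if "t \<in> {0..1}" for t x
    using DERIV_unique[OF partials_on_open_DERIV[OF Jp(2) open_UNIV that UNIV_I] Jx[OF that]] .
  then have Ct: "smooth2_on {0..1} UNIV Ct"
    by (intro smooth2_on_cong[OF Jp(1)]) auto
  obtain Ctt Ctx where Ctp: "smooth2_on {0..1} UNIV Ctx" "partials_on {0..1} UNIV Ct Ctt Ctx"
    using Ct open_UNIV by (rule smooth2_partialsE)
  have ddJ: "deriv (deriv (J t)) x = Ctx t x" if "t \<in> {0..1}" for t x
  proof -
    have "deriv (J t) = Ct t"
      using Jx[OF that] by (auto intro: DERIV_imp_deriv)
    then show ?thesis
      using DERIV_imp_deriv[OF partials_on_open_DERIV[OF Ctp(2) open_UNIV that UNIV_I]] by simp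
  qed
  \<comment> \<open>Symmetry of mixed partials for \<open>C\<close>: the time derivative of
    \<open>\<rho>\<close>, its space partial, is the space derivative of \<open>Ct\<close>, the
    space derivative of \<open>J\<close>.\<close>
  have pde: "((\<lambda>s. \<rho> s x) has_real_derivative deriv (deriv (J t)) x) (at t within {0..1})" if
      "t \<in> {0..1}" for t x
    unfolding ddJ[OF that]
    by (rule mixed_partials[OF Cp Ctp(2) smooth2_on_continuous[OF Ct] smooth2_on_continuous[OF
        Ctp(1)] convex_UNIV open_UNIV that UNIV_I])
  have D_pos: "0 < D x (\<rho> t)" if "t \<in> {0..1}" for t x
    using d_pos \<rho>(1)[OF that] \<rho>_pos[OF that] by (simp add: D_eq)
  \<comment> \<open>The potential is selected separately at each time; in \<open>CD_curve\<close>
    regularity in time is imposed on the flux, which is the already smooth \<open>J\<close>.\<close>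
  have "\<forall>t\<in>{0..1}. \<exists>p. p differentiable_on UNIV \<and> deriv p differentiable_on UNIV \<and>
      deriv (deriv p) = (\<lambda>x. J t x / D x (\<rho> t))"
  proof
    fix t :: real assume t: "t \<in> {0..1}"
    have "continuous_on UNIV (\<lambda>x. J t x / (d x (\<rho> t) * \<rho> t x))"
    proof (intro continuous_on_divide continuous_on_mult)
      show "\<forall>x\<in>UNIV. d x (\<rho> t) * \<rho> t x \<noteq> 0"
        using D_pos[OF t] D_eq[OF \<rho>(1)[OF t]] by (metis less_irrefl)
    qed (rule continuous_on_slice(2)[OF smooth2_on_continuous[OF J] t]
        d_regular[OF \<rho>(1)[OF t] smooth_line_slice[OF \<rho>_smooth t]] \<rho>_cont[OF t])+
    then have "continuous_on UNIV (\<lambda>x. J t x / D x (\<rho> t))"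
      by (simp add: D_eq[OF \<rho>(1)[OF t]])
    then show "\<exists>p. p differentiable_on UNIV \<and> deriv p differentiable_on UNIV \<and>
        deriv (deriv p) = (\<lambda>x. J t x / D x (\<rho> t))"
      by (rule second_antiderivative_UNIV) blast
  qed
  then obtain \<psi> where \<psi>: "\<And>t. t \<in> {0..1} \<Longrightarrow> \<psi> t differentiable_on UNIV"
      "\<And>t. t \<in> {0..1} \<Longrightarrow> deriv (\<psi> t) differentiable_on UNIV"
      "\<And>t. t \<in> {0..1} \<Longrightarrow> deriv (deriv (\<psi> t)) = (\<lambda>x. J t x / D x (\<rho> t))"
    by metis
  have flux: "CD_flux D \<rho> \<psi> t = J t" if "t \<in> {0..1}" for t
    using D_pos[OF that] by (auto simp: CD_flux_def \<psi>(3)[OF that] fun_eq_iff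
        order.strict_implies_not_eq[symmetric])
  have td: "time_deriv L t f = Lt t f" if "t \<in> {0..1}" "f \<in> {0<..<1}" for t f
    by (rule time_deriv_eq[where L=L, OF partials_onD(1)[OF Lp(3) that] that(1)])
  have td0: "time_deriv L t 0 = 0" if t: "t \<in> {0..1}" for t
  proof (rule time_deriv_eq[where L=L, OF _ t])
    show "((\<lambda>s. L s 0) has_real_derivative 0) (at t within {0..1})"
      by (rule has_real_derivative_cong_within[of "\<lambda>_. 0", OF _ t])
          (auto simp: r(2) lorenz_endpoints)
  qed
  have td1: "time_deriv L t 1 = 0" if t: "t \<in> {0..1}" for t
    by (rule time_deriv_eq[where L=L, OF L1[OF t] t])
  have q: "Lf t f = quantile (\<rho> t) f" if "t \<in> {0..1}" "f \<in> {0<..<1}" for t f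
    using Lf(2)[OF that] C_eq[OF that(1)] by (simp add: C_def)
  have G: "continuous_on ({0..1} \<times> {0<..<1}) (\<lambda>(t, f). quantile (\<rho> t) f)"
    by (rule continuous_on_cong[THEN iffD1, OF refl _ smooth2_on_continuous[OF Lp(2)]]) (use q
        in auto)
  have J_td: "J t x = - time_deriv L t (cum_dist (\<rho> t) x)" if "t \<in> {0..1}" for t x
    using td[OF that C01[OF that]] C_eq[OF that] by (simp add: J_def)
  note lim = uniform_limit_of_boundary_decay[OF \<rho>(1) G td_cont td0 td1]
  have lim': "uniform_limit {0..1} (\<lambda>x t. CD_flux D \<rho> \<psi> t x) (\<lambda>t. 0) at_bot"
    "uniform_limit {0..1} (\<lambda>x t. CD_flux D \<rho> \<psi> t x) (\<lambda>t. 0) at_top"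
    using lim by (simp_all add: uniform_limit_iff flux J_td)
  \<comment> \<open>Equal Lorenz curves give equal cdfs, hence equality almost everywhere with the
    given end densities, which may themselves be discontinuous.\<close>
  have "AE x in lborel. \<rho> 0 x = \<rho>0 x" "AE x in lborel. \<rho> 1 x = \<rho>1 x"
    using cum_dist_eq_if_lorenz_eq[OF \<rho>(1) \<rho>0] cum_dist_eq_if_lorenz_eq[OF \<rho>(1) \<rho>1] L_eq[of 0]
        L_eq[of 1] ends
      AE_eq_if_cum_dist_eq[OF \<rho>(1) \<rho>0] AE_eq_if_cum_dist_eq[OF \<rho>(1) \<rho>1] by auto
  moreover have "((\<lambda>s. first_moment (\<rho> s)) has_real_derivative 0) (at t within {0..1})" if
      "t \<in> {0..1}" for t
    by (rule has_real_derivative_cong_within[OF L1[OF that] that]) (simp add: L_eq lorenz_endpoints)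
  moreover have "smooth2_on {0..1} UNIV (CD_flux D \<rho> \<psi>)"
    by (rule smooth2_on_cong[OF J]) (simp add: flux)
  ultimately have "CD_curve D \<rho>0 \<rho>1 \<rho> \<psi>"
    using \<rho>(1) \<rho>_smooth \<psi>(1,2) lim' pde by (simp add: CD_curve_def flux)
  then show ?thesis using L_eq that by blast
qed

section \<open>Equality of the two infima\<close>

theorem theorem5p11:
  fixes d D :: "real \<Rightarrow> (real \<Rightarrow> real) \<Rightarrow> real"
    and \<rho>0 \<rho>1 :: "real \<Rightarrow> real"
  assumes d_pos: "\<And>x \<rho>. \<rho> \<in> pos_densities \<Longrightarrow> 0 < d x \<rho>"
    and d_regular: "\<And>\<rho>. \<rho> \<in> pos_densities \<Longrightarrow> smooth_line \<rho> \<Longrightarrow> continuous_on UNIV (\<lambda>x. d x \<rho>)"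
    and D_eq: "\<And>x \<rho>. \<rho> \<in> pos_densities \<Longrightarrow> D x \<rho> = d x \<rho> * \<rho> x"
    and \<rho>0: "\<rho>0 \<in> pos_densities"
    and \<rho>1: "\<rho>1 \<in> pos_densities"
    and same_mean: "first_moment \<rho>0 = first_moment \<rho>1"
  shows "CD_dist_sq D \<rho>0 \<rho>1 = lorenz_dist_sq d (lorenz \<rho>0) (lorenz \<rho>1)"
proof (rule antisym)
  \<comment> \<open>Costs are compared for an arbitrary matched pair, so one identity serves both
    inequalities. Every admissible object on one side has a partner on the other, which also covers
    the case of two empty families.\<close>
  have cost: "(\<integral>\<^sup>+t\<in>{0..1}. lorenz_norm_sq d (L t) (time_deriv L t) \<partial>lborel) =
      (\<integral>\<^sup>+t\<in>{0..1}. (\<integral>\<^sup>+x. ennreal (D x (\<rho> t) * (deriv (deriv (\<psi> t)) x)\<^sup>2) \<partial>lborel) \<partial>lborel)"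
    if curve: "CD_curve D \<rho>0 \<rho>1 \<rho> \<psi>" and L: "\<And>t. t \<in> {0..1} \<Longrightarrow> L t = lorenz (\<rho> t)" for \<rho> \<psi> L
  proof (intro nn_integral_cong)
    fix t :: real
    have "lorenz_norm_sq d (L t) (time_deriv L t)
        = (\<integral>\<^sup>+x. ennreal (D x (\<rho> t) * (deriv (deriv (\<psi> t)) x)\<^sup>2) \<partial>lborel)"
      if t: "t \<in> {0..1}"
      unfolding L[OF t]
    proof (rule lorenz_norm_sq_eq_CD_energy[OF d_pos d_regular D_eq _ _ _ t])
      \<comment> \<open>\<open>L\<close> and the Lorenz curves of \<open>\<rho>\<close> are known to
        agree only on \<open>{0..1}\<close>; the derivative relative to that interval sees nothing
        else.\<close>
      have "time_deriv L t f = time_deriv (\<lambda>t. lorenz (\<rho> t)) t f" for f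
        unfolding time_deriv_def
        by (rule vector_derivative_cong_eq) (use L t in \<open>auto simp: eventually_at_filter\<close>)
      then show "time_deriv L t f = - CD_flux D \<rho> \<psi> t (quantile (\<rho> t) f)" if "0 < f" "f < 1" for f
        using lorenz_path_of_CD_curve(2)[OF \<rho>0 \<rho>1 curve t that] by simp
    qed (use curve t in \<open>auto simp: CD_curve_def\<close>)
    then show "lorenz_norm_sq d (L t) (time_deriv L t) * indicator {0..1} t =
        (\<integral>\<^sup>+x. ennreal (D x (\<rho> t) * (deriv (deriv (\<psi> t)) x)\<^sup>2) \<partial>lborel) * indicator {0..1} t"
      by (simp split: split_indicator)
  qed
  show "CD_dist_sq D \<rho>0 \<rho>1 \<le> lorenz_dist_sq d (lorenz \<rho>0) (lorenz \<rho>1)"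
    unfolding lorenz_dist_sq_def
  proof (rule INF_greatest)
    fix L assume "L \<in> {\<L>. lorenz_path (lorenz \<rho>0) (lorenz \<rho>1) \<L>}"
    then obtain \<rho> \<psi> where \<rho>\<psi>: "CD_curve D \<rho>0 \<rho>1 \<rho> \<psi>" "\<And>t. t \<in> {0..1} \<Longrightarrow> L t = lorenz (\<rho> t)"
      using CD_curve_of_lorenz_path[OF d_pos d_regular D_eq \<rho>0 \<rho>1] by blast
    have "CD_dist_sq D \<rho>0 \<rho>1 \<le>
        (\<integral>\<^sup>+t\<in>{0..1}. (\<integral>\<^sup>+x. ennreal (D x (\<rho> t) * (deriv (deriv (\<psi> t)) x)\<^sup>2) \<partial>lborel) \<partial>lborel)"
      unfolding CD_dist_sq_def by (rule INF_lower2[of "(\<rho>, \<psi>)"]) (use \<rho>\<psi>(1) in auto)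
    also have "\<dots> = (\<integral>\<^sup>+t\<in>{0..1}. lorenz_norm_sq d (L t) (time_deriv L t) \<partial>lborel)"
      by (rule cost[OF \<rho>\<psi>, symmetric])
    finally show "CD_dist_sq D \<rho>0 \<rho>1 \<le> (\<integral>\<^sup>+t\<in>{0..1}. lorenz_norm_sq d (L t) (time_deriv L t)
        \<partial>lborel)" .
  qed
  show "lorenz_dist_sq d (lorenz \<rho>0) (lorenz \<rho>1) \<le> CD_dist_sq D \<rho>0 \<rho>1"
    unfolding CD_dist_sq_def
  proof (rule INF_greatest, clarify)
    fix \<rho> \<psi> assume curve: "CD_curve D \<rho>0 \<rho>1 \<rho> \<psi>"
    show "lorenz_dist_sq d (lorenz \<rho>0) (lorenz \<rho>1) \<le>
        (\<integral>\<^sup>+t\<in>{0..1}. (\<integral>\<^sup>+x. ennreal (D x (\<rho> t) * (deriv (deriv (\<psi> t)) x)\<^sup>2) \<partial>lborel) \<partial>lborel)"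
      unfolding lorenz_dist_sq_def cost[OF curve refl, symmetric]
      by (rule INF_lower) (use lorenz_path_of_CD_curve(1)[OF \<rho>0 \<rho>1 curve] in simp)
  qed
qed

end
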